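(* Let $(\Phi,\mathfrak N,\mathfrak T,\mathfrak R,\mathfrak S,\phi_{\mathrm{start}},\Sigma,\mathrm{Lex},\mathrm{Sel})$ be a parameterized local lexing and $D\in\Sigma^*$. Let $\mathfrak I$ be the result of the algorithm PELLA on $D$ and $\sigma(D)$ the set of outputs of $D$ (both defined below). Then $$\sigma(D)=\{\rho_{2u+1}\mid (r,u,0,|D|,\rho)\in\mathfrak I \text{ where } r=\mathfrak S_{f_{u+1}}\to X_1^{f_1}\cdots X_u^{f_u}\in\mathfrak R \text{ has } u \text{ right-hand symbols, and } \rho_0=\phi_{\mathrm{start}}\}.$$
   Context: Parameterized local lexing: $\Phi$ is a non-empty set of parameters; $\mathfrak N,\mathfrak T$ are disjoint sets of nonterminals and terminals; $\mathfrak S\in\mathfrak N$, $\phi_{\mathrm{start}}\in\Phi$; $\mathfrak R$ is a set of parameterized rules $N_{f_{k+1}}\to X_1^{f_1}\cdots X_k^{f_k}$ with $k\ge0$, $N\in\mathfrak N$, $X_i\in\mathfrak N\cup\mathfrak T$, partial functions $f_i:\Phi^{2i-1}\rightharpoonup\Phi$ ($i=1,\dots,k+1$); $\Sigma$ is a set of characters; $\mathrm{Lex}$ assigns to each $(t,\alpha,D,k)$ with $t\in\mathfrak T,\alpha\in\Phi,D\in\Sigma^*,0\le k\le|D|$ a set of parameterized tokens $(t,\alpha,\beta,c)$ with $\beta\in\Phi$, $c\in\Sigma^*$, $k+|c|\le|D|$, $c_i=D_{k+i}$ for $0\le i<|c|$; $\mathrm{Sel}$ maps pairs $(A,B)$ of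 subsets of $\mathfrak T\times\Phi\times\Phi\times\Sigma^*$ to a set with $A\subseteq\mathrm{Sel}(A,B)\subseteq B$ whenever $A\subseteq B$. Sequences are indexed from 0; juxtaposition is concatenation. For $f_1,\dots,f_u$, $\langle f_1,\dots,f_u\rangle$ is the set of $\rho\in\Phi^{2u}$ with $f_i$ defined at $(\rho_0,\dots,\rho_{2i-2})$ and $\rho_{2i-1}=f_i(\rho_0,\dots,\rho_{2i-2})$ for $i=1,\dots,u$. Induced grammar: nonterminals $(\mathfrak N\times\Phi\times\Phi)\cup\{\top,\bot\}$, terminals $\overline{\mathfrak T}=\mathfrak T\times\Phi\times\Phi$, start symbol $\top$, writing $N^\alpha_\beta,t^\alpha_\beta$ for triples. Rules: $\top\to\mathfrak S^{\phi_{\mathrm{start}}}_\beta$ ($\beta\in\Phi$), and for each $r=N_{f_{k+1}}\to X_1^{f_1}\cdots X_k^{f_k}\in\mathfrak R$: (i) $N^\alpha_\beta\to(X_1)^{\alpha_1}_{\beta_1}\cdots(X_k)^{\alpha_k}_{\beta_k}$ whenever $(\alpha,\alpha_1,\beta_1,\dots,\alpha_k,\beta_k,\beta)\in\langle f_1,\dots,f_{k+1}\rangle$; (ii) $N^\alpha_\beta\to(X_1)^{\alpha_1}_{\beta_1}\cdots(X_h)^{\alpha_h}_{\beta_h}\bot$ whenever $1\le h\le k$, $\beta,\beta_h\in\Phi$, $(\alpha,\alpha_1,\beta_1,\dots,\alpha_h)\in\langle f_1,\dots,f_h\rangle$ and $f_{h+1}$ is undefined at $(\alpha,\alpha_1,\beta_1,\dots,\alpha_h,\beta_h)$.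 ($\bot$ has no rules.) Induced lexer: $\overline{\mathrm{Lex}}(t^\alpha_\beta)(D,k)=\{(t^\alpha_\beta,c)\mid(t,\alpha,\beta,c)\in\mathrm{Lex}(t,\alpha,D,k)\}$; with $\mathcal U(t,\alpha,\beta,c)=(t^\alpha_\beta,c)$ lifted to sets, induced selector $\overline{\mathrm{Sel}}(A,B)=\mathcal U(\mathrm{Sel}(\mathcal U^{-1}A,\mathcal U^{-1}B))$. Local lexing semantics (for the induced grammar, lexer, selector): $\mathcal L$ is the set of terminal strings derivable from $\top$, $\mathcal L_{\mathrm{prefix}}$ the set of their prefixes. A token is $(t,c)\in\overline{\mathfrak T}\times\Sigma^*$, a path $p$ a finite sequence of tokens, $\overline p$ the concatenation of its character parts, $[p]$ its sequence of terminals. $\mathcal X_k=\bigcup_{t\in\overline{\mathfrak T}}\overline{\mathrm{Lex}}(t)(D,k)$. $\mathrm{Append}_{T,k}(P)=P\cup\{p\,x\mid p\in P,|\overline p|=k,x\in T,[p\,x]\in\mathcal L_{\mathrm{prefix}}\}$; $\mathrm{limit}\,f\,X=\bigcup_{n\ge0}f^n(X)$. Define $\mathcal P_0^0=\{\varepsilon\}$; $\mathcal Z_k^0=\emptyset$; $\mathcal W_k^u=\{x\in\mathcal X_k\mid\exists p\in\mathcal P_k^u: |\overline p|=k\wedge[p\,x]\in\mathcal L_{\mathrm{prefix}}\}$; $\mathcal Z_k^{u+1}=\overline{\mathrm{Sel}}(\mathcal Z_k^u,\mathcal W_k^u)$; $\mathcal P_k^{u+1}=\mathrm{limit}\,\mathrm{Append}_{\mathcal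 Z_k^{u+1},k}\,\mathcal P_k^u$; $\mathcal P_k=\bigcup_u\mathcal P_k^u$; $\mathcal P_{k+1}^0=\mathcal P_k$; $\mathfrak P=\mathcal P_{|D|}$; $\ell\ell(D)=\{p\in\mathfrak P\mid\overline p=D\wedge[p]\in\mathcal L\}$. Outputs: $\sigma(D)=\{\beta\mid\exists p\in\ell\ell(D):\top\Rightarrow\mathfrak S^{\phi_{\mathrm{start}}}_\beta\Rightarrow^*[p]\}$. PELLA: a parameterized item is $(r,d,i,j,\rho)$ with $r=N_{f_{v+1}}\to X_1^{f_1}\cdots X_v^{f_v}\in\mathfrak R$, $0\le d\le v$, $0\le i\le j\le|D|$, $\rho\in\langle f_1,\dots,f_{d+1}\rangle$ ($d$ is the dot position). For $0\le k\le|D|$, item sets $I$, parameterized token sets $T$: $\mathrm{Init}=\{(r,0,0,0,(\phi_{\mathrm{start}},f_1(\phi_{\mathrm{start}})))\mid r\in\mathfrak R \text{ has left side }\mathfrak S,\ f_1\text{ defined at }\phi_{\mathrm{start}}\}$; $\mathrm{Predict}\,k\,I=I\cup\{(r',0,k,k,(\rho_{2d+1},g_1(\rho_{2d+1})))\mid(r,d,i,k,\rho)\in I,d<v,X_{d+1}=M,\ r'=M_{g_{u+1}}\to Y_1^{g_1}\cdots Y_u^{g_u}\in\mathfrak R,\ g_1\text{ defined at }\rho_{2d+1}\}$; $\mathrm{Complete}\,k\,I=I\cup\{(r,d+1,i,k,\rho'\,f_{d+2}(\rho'))\mid(r,d,i,j,\rho)\in I,d<v,X_{d+1}=M,\ (r',u,j,k,\xi)\in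 I\text{ with }r'=M_{g_{u+1}}\to Y_1^{g_1}\cdots Y_u^{g_u},\ \rho_{2d+1}=\xi_0,\ \rho'=\rho\,\xi_{2u+1},\ f_{d+2}\text{ defined at }\rho'\}$; $\mathrm{Tokens}\,T\,k\,I=\mathrm{Sel}(T,\{x\mid(r,d,i,k,\rho)\in I,d<v,X_{d+1}\in\mathfrak T,x\in\mathrm{Lex}(X_{d+1},\rho_{2d+1},D,k)\})$; $\mathrm{Scan}\,T\,k\,I=I\cup\{(r,d+1,i,k+|c|,\rho'\,f_{d+2}(\rho'))\mid(r,d,i,k,\rho)\in I,d<v,(X_{d+1},\rho_{2d+1},\beta,c)\in T,\rho'=\rho\,\beta,f_{d+2}\text{ defined at }\rho'\}$ (here $r=N_{f_{v+1}}\to X_1^{f_1}\cdots X_v^{f_v}$). Then $\pi_k\,T\,I=\mathrm{limit}(\mathrm{Scan}\,T\,k\circ\mathrm{Complete}\,k\circ\mathrm{Predict}\,k)\,I$; $\mathcal J_0^0=\pi_0\,\emptyset\,\mathrm{Init}$; $\mathcal T_k^0=\emptyset$; $\mathcal T_k^{u+1}=\mathrm{Tokens}\,\mathcal T_k^u\,k\,\mathcal J_k^u$; $\mathcal J_k^{u+1}=\pi_k\,\mathcal T_k^{u+1}\,\mathcal J_k^u$; $\mathcal I_k=\bigcup_{u\ge0}\mathcal J_k^u$; $\mathcal J_{k+1}^0=\pi_{k+1}\,\emptyset\,\mathcal I_k$; $\mathfrak I=\mathcal I_{|D|}$.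
   Formalization: L_prefix is taken as the terminal prefixes of all sentential forms derivable from ⊤ (the rest may contain nonterminals or ⊥), not only prefixes of words of L; with the latter the claim fails, e.g. for S→a, S→cM, M without rules, and Sel dropping a when c is offered. *)

theory Defs
  imports Main
begin

section \<open>Local lexing\<close>

text \<open>Nonterminals and terminals are carrier subsets of one type of symbols.\<close>

record ('a, 'c) local_lexing =
  nonterminals :: "'a set"
  terminals :: "'a set"
  productions :: "('a \<times> 'a list) set"
  start_symbol :: "'a"
  lexer :: "'a \<Rightarrow> 'c list \<Rightarrow> nat \<Rightarrow> ('a \<times> 'c list) set"
  selector :: "('a \<times> 'c list) set \<Rightarrow> ('a \<times> 'c list) set \<Rightarrow> ('a \<times> 'c list) set"

type_synonym ('a, 'c) token = "'a \<times> 'c list"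
type_synonym ('a, 'c) path = "('a, 'c) token list"

definition derives1 :: "('a, 'c) local_lexing \<Rightarrow> 'a list \<Rightarrow> 'a list \<Rightarrow> bool" where
  "derives1 G v w \<longleftrightarrow>
     (\<exists>x N y \<gamma>. v = x @ [N] @ y \<and> w = x @ \<gamma> @ y \<and> (N, \<gamma>) \<in> productions G)"

definition derives :: "('a, 'c) local_lexing \<Rightarrow> 'a list \<Rightarrow> 'a list \<Rightarrow> bool" where
  "derives G = (derives1 G)\<^sup>*\<^sup>*"

definition language :: "('a, 'c) local_lexing \<Rightarrow> 'a list set" where
  "language G = {w \<in> lists (terminals G). derives G [start_symbol G] w}"

text \<open>
  A prefix is a terminal string that starts a derivable sentential form. The remainder of the form
  may contain nonterminals, and these need not be productive: the induced grammar below uses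
  the unproductive symbol \<open>Bot\<close> as the remainder of a form whose parse cannot be completed.
\<close>

definition language_prefix :: "('a, 'c) local_lexing \<Rightarrow> 'a list set" where
  "language_prefix G =
     {w \<in> lists (terminals G).
        \<exists>v \<in> lists (nonterminals G \<union> terminals G). derives G [start_symbol G] (w @ v)}"

definition path_chars :: "('a, 'c) path \<Rightarrow> 'c list" where
  "path_chars p = concat (map snd p)"

definition path_terminals :: "('a, 'c) path \<Rightarrow> 'a list" where
  "path_terminals p = map fst p"

definition limit :: "('b set \<Rightarrow> 'b set) \<Rightarrow> 'b set \<Rightarrow> 'b set" where
  "limit f X = (\<Union>n. (f ^^ n) X)"

definition Append ::
  "('a, 'c) local_lexing \<Rightarrow> ('a, 'c) token set \<Rightarrow> nat \<Rightarrow> ('a, 'c) path set \<Rightarrow> ('a, 'c) path set" where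
  "Append G T k P =
     P \<union> {p @ [x] | p x. p \<in> P \<and> length (path_chars p) = k \<and> x \<in> T \<and>
                          path_terminals (p @ [x]) \<in> language_prefix G}"

definition tokens_at :: "('a, 'c) local_lexing \<Rightarrow> 'c list \<Rightarrow> nat \<Rightarrow> ('a, 'c) token set" where
  "tokens_at G D k = (\<Union>t \<in> terminals G. lexer G t D k)"

definition tokens_following ::
  "('a, 'c) local_lexing \<Rightarrow> 'c list \<Rightarrow> nat \<Rightarrow> ('a, 'c) path set \<Rightarrow> ('a, 'c) token set" where
  "tokens_following G D k P =
     {x \<in> tokens_at G D k.
        \<exists>p \<in> P. length (path_chars p) = k \<and> path_terminals (p @ [x]) \<in> language_prefix G}"

function paths :: "('a, 'c) local_lexing \<Rightarrow> 'c list \<Rightarrow> nat \<Rightarrow> nat \<Rightarrow> ('a, 'c) path set"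
  and selected :: "('a, 'c) local_lexing \<Rightarrow> 'c list \<Rightarrow> nat \<Rightarrow> nat \<Rightarrow> ('a, 'c) token set"
where
  "paths G D 0 0 = {[]}"
| "paths G D (Suc k) 0 = (\<Union>u. paths G D k u)"
| "paths G D k (Suc u) = limit (Append G (selected G D k (Suc u)) k) (paths G D k u)"
| "selected G D k 0 = {}"
| "selected G D k (Suc u) =
     selector G (selected G D k u) (tokens_following G D k (paths G D k u))"
  by pat_completeness auto
termination
  by (relation "measures
        [\<lambda>x. case x of Inl (G, D, k, u) \<Rightarrow> k | Inr (G, D, k, u) \<Rightarrow> k,
         \<lambda>x. case x of Inl (G, D, k, u) \<Rightarrow> u | Inr (G, D, k, u) \<Rightarrow> u,
         \<lambda>x. case x of Inl _ \<Rightarrow> 1 | Inr _ \<Rightarrow> 0]") auto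

definition all_paths :: "('a, 'c) local_lexing \<Rightarrow> 'c list \<Rightarrow> ('a, 'c) path set" where
  "all_paths G D = (\<Union>u. paths G D (length D) u)"

definition parses :: "('a, 'c) local_lexing \<Rightarrow> 'c list \<Rightarrow> ('a, 'c) path set" where
  "parses G D = {p \<in> all_paths G D. path_chars p = D \<and> path_terminals p \<in> language G}"


section \<open>Parameterized local lexing\<close>

text \<open>
  \<open>Rule N g [(X\<^sub>1, f\<^sub>1), \<dots>, (X\<^sub>k, f\<^sub>k)]\<close> is the rule with left side \<open>N\<close>, right side
  \<open>X\<^sub>1 \<dots> X\<^sub>k\<close> and partial functions \<open>f\<^sub>1, \<dots>, f\<^sub>k, f\<^sub>k\<^sub>+\<^sub>1 = g\<close>. Lists are indexed from 0, so
  \<open>rule_syms r ! d\<close> is \<open>X\<^sub>d\<^sub>+\<^sub>1\<close> and \<open>rule_funs r ! d\<close> is \<open>f\<^sub>d\<^sub>+\<^sub>1\<close>.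
\<close>

datatype ('p, 's) rule =
  Rule (lhs: 's) (lhs_fun: "'p list \<rightharpoonup> 'p") (rhs: "('s \<times> ('p list \<rightharpoonup> 'p)) list")

definition rule_len :: "('p, 's) rule \<Rightarrow> nat" where
  "rule_len r = length (rhs r)"

definition rule_syms :: "('p, 's) rule \<Rightarrow> 's list" where
  "rule_syms r = map fst (rhs r)"

definition rule_funs :: "('p, 's) rule \<Rightarrow> ('p list \<rightharpoonup> 'p) list" where
  "rule_funs r = map snd (rhs r) @ [lhs_fun r]"

type_synonym ('p, 's, 'c) ptoken = "'s \<times> 'p \<times> 'p \<times> 'c list"

record ('p, 's, 'c) pll =
  Params :: "'p set"
  Nonterms :: "'s set"
  Terms :: "'s set"
  Rules :: "('p, 's) rule set"
  Start :: "'s"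
  start_param :: "'p"
  Chars :: "'c set"
  Lex :: "'s \<Rightarrow> 'p \<Rightarrow> 'c list \<Rightarrow> nat \<Rightarrow> ('p, 's, 'c) ptoken set"
  Sel :: "('p, 's, 'c) ptoken set \<Rightarrow> ('p, 's, 'c) ptoken set \<Rightarrow> ('p, 's, 'c) ptoken set"

locale parameterized_local_lexing =
  fixes L :: "('p, 's, 'c) pll"
  assumes params_nonempty: "Params L \<noteq> {}"
    and disjoint: "Nonterms L \<inter> Terms L = {}"
    and start_nonterm: "Start L \<in> Nonterms L"
    and start_param: "start_param L \<in> Params L"
    and rule_lhs: "r \<in> Rules L \<Longrightarrow> lhs r \<in> Nonterms L"
    and rule_rhs: "r \<in> Rules L \<Longrightarrow> set (rule_syms r) \<subseteq> Nonterms L \<union> Terms L"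
    and rule_dom: "\<lbrakk>r \<in> Rules L; i \<le> rule_len r\<rbrakk> \<Longrightarrow>
      dom (rule_funs r ! i) \<subseteq> {xs \<in> lists (Params L). length xs = 2 * i + 1}"
    and rule_ran: "\<lbrakk>r \<in> Rules L; i \<le> rule_len r\<rbrakk> \<Longrightarrow> ran (rule_funs r ! i) \<subseteq> Params L"
    and Lex: "\<lbrakk>t \<in> Terms L; \<alpha> \<in> Params L; D \<in> lists (Chars L); k \<le> length D;
        x \<in> Lex L t \<alpha> D k\<rbrakk> \<Longrightarrow>
      \<exists>\<beta> c. x = (t, \<alpha>, \<beta>, c) \<and> \<beta> \<in> Params L \<and> c \<in> lists (Chars L) \<and>
        k + length c \<le> length D \<and> (\<forall>i < length c. c ! i = D ! (k + i))"
    and Sel: "\<lbrakk>A \<subseteq> B; B \<subseteq> Terms L \<times> Params L \<times> Params L \<times> lists (Chars L)\<rbrakk> \<Longrightarrow>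
      A \<subseteq> Sel L A B \<and> Sel L A B \<subseteq> B"

text \<open>\<open>param_seqs \<Phi> [f\<^sub>1, \<dots>, f\<^sub>u]\<close> is \<open>\<langle>f\<^sub>1, \<dots>, f\<^sub>u\<rangle>\<close>.\<close>

definition param_seqs :: "'p set \<Rightarrow> ('p list \<rightharpoonup> 'p) list \<Rightarrow> 'p list set" where
  "param_seqs \<Phi> fs =
     {\<rho> \<in> lists \<Phi>. length \<rho> = 2 * length fs \<and>
        (\<forall>i < length fs. (fs ! i) (take (2 * i + 1) \<rho>) = Some (\<rho> ! (2 * i + 1)))}"


section \<open>Induced local lexing and outputs\<close>

datatype ('p, 's) isym = Sym 's 'p 'p | Top | Bot

text \<open>
  In \<open>\<rho> = (\<alpha>, \<alpha>\<^sub>1, \<beta>\<^sub>1, \<alpha>\<^sub>2, \<beta>\<^sub>2, \<dots>)\<close> the parameters \<open>\<alpha>\<^sub>i\<^sub>+\<^sub>1\<close> and \<open>\<beta>\<^sub>i\<^sub>+\<^sub>1\<close> have indices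
  \<open>2 * i + 1\<close> and \<open>2 * i + 2\<close>.
\<close>

definition annotate :: "'s list \<Rightarrow> 'p list \<Rightarrow> ('p, 's) isym list" where
  "annotate Xs \<rho> = map (\<lambda>i. Sym (Xs ! i) (\<rho> ! (2 * i + 1)) (\<rho> ! (2 * i + 2))) [0..<length Xs]"

definition induced_productions ::
  "('p, 's, 'c) pll \<Rightarrow> (('p, 's) isym \<times> ('p, 's) isym list) set" where
  "induced_productions L =
     {(Top, [Sym (Start L) (start_param L) \<beta>]) | \<beta>. \<beta> \<in> Params L} \<union>
     {(Sym (lhs r) (\<rho> ! 0) (\<rho> ! (2 * rule_len r + 1)), annotate (rule_syms r) \<rho>) | r \<rho>.
        r \<in> Rules L \<and> \<rho> \<in> param_seqs (Params L) (rule_funs r)} \<union>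
     {(Sym (lhs r) (\<rho> ! 0) \<beta>, annotate (take h (rule_syms r)) (\<rho> @ [\<beta>\<^sub>h]) @ [Bot]) | r h \<rho> \<beta> \<beta>\<^sub>h.
        r \<in> Rules L \<and> 1 \<le> h \<and> h \<le> rule_len r \<and> \<beta> \<in> Params L \<and> \<beta>\<^sub>h \<in> Params L \<and>
        \<rho> \<in> param_seqs (Params L) (take h (rule_funs r)) \<and>
        (rule_funs r ! h) (\<rho> @ [\<beta>\<^sub>h]) = None}"

fun induced_lexer ::
  "('p, 's, 'c) pll \<Rightarrow> ('p, 's) isym \<Rightarrow> 'c list \<Rightarrow> nat \<Rightarrow> (('p, 's) isym, 'c) token set" where
  "induced_lexer L (Sym t \<alpha> \<beta>) D k = {(Sym t \<alpha> \<beta>, c) | c. (t, \<alpha>, \<beta>, c) \<in> Lex L t \<alpha> D k}"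
| "induced_lexer L Top D k = {}"
| "induced_lexer L Bot D k = {}"

fun induced_token :: "('p, 's, 'c) ptoken \<Rightarrow> (('p, 's) isym, 'c) token" where
  "induced_token (t, \<alpha>, \<beta>, c) = (Sym t \<alpha> \<beta>, c)"

definition induced_selector ::
  "('p, 's, 'c) pll \<Rightarrow> (('p, 's) isym, 'c) token set \<Rightarrow> (('p, 's) isym, 'c) token set \<Rightarrow>
   (('p, 's) isym, 'c) token set" where
  "induced_selector L A B = induced_token ` Sel L (induced_token -` A) (induced_token -` B)"

definition induced :: "('p, 's, 'c) pll \<Rightarrow> (('p, 's) isym, 'c) local_lexing" where
  "induced L =
     \<lparr>nonterminals =
        {Sym N \<alpha> \<beta> | N \<alpha> \<beta>. N \<in> Nonterms L \<and> \<alpha> \<in> Params L \<and> \<beta> \<in> Params L} \<union> {Top, Bot},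
      terminals = {Sym t \<alpha> \<beta> | t \<alpha> \<beta>. t \<in> Terms L \<and> \<alpha> \<in> Params L \<and> \<beta> \<in> Params L},
      productions = induced_productions L,
      start_symbol = Top,
      lexer = induced_lexer L,
      selector = induced_selector L\<rparr>"

definition outputs :: "('p, 's, 'c) pll \<Rightarrow> 'c list \<Rightarrow> 'p set" where
  "outputs L D =
     {\<beta>. \<exists>p \<in> parses (induced L) D.
        derives1 (induced L) [Top] [Sym (Start L) (start_param L) \<beta>] \<and>
        derives (induced L) [Sym (Start L) (start_param L) \<beta>] (path_terminals p)}"


section \<open>The algorithm PELLA\<close>

text \<open>
  An item \<open>(r, d, i, j, \<rho>)\<close> has the dot after the first \<open>d\<close> symbols of the right side of \<open>r\<close>. The
  constraints \<open>r \<in> Rules L\<close>, \<open>d \<le> rule_len r\<close>, \<open>i \<le> j \<le> length D\<close> and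
  \<open>\<rho> \<in> param_seqs (Params L) (take (d + 1) (rule_funs r))\<close> are invariants of the algorithm.
\<close>

type_synonym ('p, 's) item = "('p, 's) rule \<times> nat \<times> nat \<times> nat \<times> 'p list"

definition Init :: "('p, 's, 'c) pll \<Rightarrow> ('p, 's) item set" where
  "Init L =
     {(r, 0, 0, 0, [start_param L, \<gamma>]) | r \<gamma>.
        r \<in> Rules L \<and> lhs r = Start L \<and> (rule_funs r ! 0) [start_param L] = Some \<gamma>}"

definition Predict :: "('p, 's, 'c) pll \<Rightarrow> nat \<Rightarrow> ('p, 's) item set \<Rightarrow> ('p, 's) item set" where
  "Predict L k I =
     I \<union> {(r', 0, k, k, [\<rho> ! (2 * d + 1), \<gamma>]) | r d i \<rho> r' \<gamma>.
            (r, d, i, k, \<rho>) \<in> I \<and> d < rule_len r \<and>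
            r' \<in> Rules L \<and> lhs r' = rule_syms r ! d \<and>
            (rule_funs r' ! 0) [\<rho> ! (2 * d + 1)] = Some \<gamma>}"

definition Complete :: "nat \<Rightarrow> ('p, 's) item set \<Rightarrow> ('p, 's) item set" where
  "Complete k I =
     I \<union> {(r, d + 1, i, k, \<rho>' @ [\<gamma>]) | r d i j \<rho> r' u \<xi> \<rho>' \<gamma>.
            (r, d, i, j, \<rho>) \<in> I \<and> d < rule_len r \<and>
            (r', u, j, k, \<xi>) \<in> I \<and> u = rule_len r' \<and> lhs r' = rule_syms r ! d \<and>
            \<rho> ! (2 * d + 1) = \<xi> ! 0 \<and> \<rho>' = \<rho> @ [\<xi> ! (2 * u + 1)] \<and>
            (rule_funs r ! (d + 1)) \<rho>' = Some \<gamma>}"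

definition Tokens ::
  "('p, 's, 'c) pll \<Rightarrow> 'c list \<Rightarrow> ('p, 's, 'c) ptoken set \<Rightarrow> nat \<Rightarrow> ('p, 's) item set \<Rightarrow>
   ('p, 's, 'c) ptoken set" where
  "Tokens L D T k I =
     Sel L T {x. \<exists>r d i \<rho>. (r, d, i, k, \<rho>) \<in> I \<and> d < rule_len r \<and> rule_syms r ! d \<in> Terms L \<and>
                 x \<in> Lex L (rule_syms r ! d) (\<rho> ! (2 * d + 1)) D k}"

definition Scan ::
  "('p, 's, 'c) ptoken set \<Rightarrow> nat \<Rightarrow> ('p, 's) item set \<Rightarrow> ('p, 's) item set" where
  "Scan T k I =
     I \<union> {(r, d + 1, i, k + length c, \<rho>' @ [\<gamma>]) | r d i \<rho> \<beta> c \<rho>' \<gamma>.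
            (r, d, i, k, \<rho>) \<in> I \<and> d < rule_len r \<and>
            (rule_syms r ! d, \<rho> ! (2 * d + 1), \<beta>, c) \<in> T \<and> \<rho>' = \<rho> @ [\<beta>] \<and>
            (rule_funs r ! (d + 1)) \<rho>' = Some \<gamma>}"

definition saturate ::
  "('p, 's, 'c) pll \<Rightarrow> nat \<Rightarrow> ('p, 's, 'c) ptoken set \<Rightarrow> ('p, 's) item set \<Rightarrow> ('p, 's) item set" where
  "saturate L k T I = limit (Scan T k \<circ> Complete k \<circ> Predict L k) I"

function items :: "('p, 's, 'c) pll \<Rightarrow> 'c list \<Rightarrow> nat \<Rightarrow> nat \<Rightarrow> ('p, 's) item set"
  and item_tokens :: "('p, 's, 'c) pll \<Rightarrow> 'c list \<Rightarrow> nat \<Rightarrow> nat \<Rightarrow> ('p, 's, 'c) ptoken set"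
where
  "items L D 0 0 = saturate L 0 {} (Init L)"
| "items L D (Suc k) 0 = saturate L (Suc k) {} (\<Union>u. items L D k u)"
| "items L D k (Suc u) = saturate L k (item_tokens L D k (Suc u)) (items L D k u)"
| "item_tokens L D k 0 = {}"
| "item_tokens L D k (Suc u) = Tokens L D (item_tokens L D k u) k (items L D k u)"
  by pat_completeness auto
termination
  by (relation "measures
        [\<lambda>x. case x of Inl (L, D, k, u) \<Rightarrow> k | Inr (L, D, k, u) \<Rightarrow> k,
         \<lambda>x. case x of Inl (L, D, k, u) \<Rightarrow> u | Inr (L, D, k, u) \<Rightarrow> u,
         \<lambda>x. case x of Inl _ \<Rightarrow> 1 | Inr _ \<Rightarrow> 0]") auto

definition PELLA :: "('p, 's, 'c) pll \<Rightarrow> 'c list \<Rightarrow> ('p, 's) item set" where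
  "PELLA L D = (\<Union>u. items L D (length D) u)"

end

theory Submission
  imports Defs
begin

text \<open>
  Both the path sets and the item sets are determined by the tokens selected so far at each position.
  The paths are the sequences whose types form a viable prefix and whose tokens were selected at the
  positions where they start. The items are sound for these paths, and complete for the positions up to
  the current one. By induction over the stages the candidate tokens offered to the selectors therefore
  agree, and hence so do the selected tokens.

  The guessed output parameters of the induced grammar do no harm: every item with an unfinished
  right side extends to an induced production for any guessed output parameter of the next symbol,
  because a guess at which the next function is undefined is absorbed by \<open>Bot\<close>.
\<close>

section \<open>Derivations\<close>

text \<open>Two obstacles shape the proof. A path is only a prefix of a sentential form, so there
  need not be a terminal string that completes it. And tokens may be empty, so the position reached
  is no measure for an induction. Completeness therefore goes by induction over derivation trees
  (\<open>yields\<close>) whose frontier is cut at an arbitrary place into a scanned path and a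
  remainder. This argument needs one item set that is closed under the operations at every position
  up to \<open>k\<close>, whereas a stage saturates at its own position alone. Closure at earlier
  positions survives because leaving position \<open>j\<close> freezes all items that end at
  \<open>j\<close>. Soundness and completeness are both stated for a given family of token sets,
  without the selector. It enters through \<open>A \<subseteq> Sel L A B \<subseteq> B\<close>: the
  upper bound keeps tokens well formed, the lower one makes the selected sets grow, so that finitely
  many facts from different stages can be moved to a common stage.\<close>

lemma derives_refl: "derives G w w"
  by (simp add: derives_def)

lemma derives_trans [trans]: "derives G u v \<Longrightarrow> derives G v w \<Longrightarrow> derives G u w"
  by (auto simp: derives_def)

lemma derives1_context: "derives1 G v w \<Longrightarrow> derives1 G (x @ v @ y) (x @ w @ y)"
  unfolding derives1_def by (metis append.assoc)

lemma derives_context: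
  assumes "derives G v w" shows "derives G (x @ v @ y) (x @ w @ y)"
  using assms unfolding derives_def
  by induction (auto intro: rtranclp.rtrancl_into_rtrancl derives1_context)

lemma derives_append:
  assumes "derives G v v'" and "derives G w w'" shows "derives G (v @ w) (v' @ w')"
  using derives_context[OF assms(1), of "[]" w] derives_context[OF assms(2), of v' "[]"]
  by (auto intro: derives_trans)

lemma derives_production:
  assumes "(N, \<gamma>) \<in> productions G" shows "derives G [N] \<gamma>"
proof -
  have "derives1 G [N] \<gamma>"
    unfolding derives1_def using assms by (intro exI[of _ "[]"] exI[of _ N] exI[of _ \<gamma>]) auto
  then show ?thesis by (auto simp: derives_def)
qed

text \<open>A forest of partial derivation trees with roots \<open>s\<close> and frontier
  \<open>w\<close>. Unlike a sequence of rewriting steps, it can be taken apart symbol by symbol.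
  The rule \<open>keep\<close> applies to nonterminals too, since the frontier may be any sentential
  form.\<close>

inductive yields :: "('a, 'c) local_lexing \<Rightarrow> 'a list \<Rightarrow> 'a list \<Rightarrow> bool" for G where
  Nil: "yields G [] []"
| keep: "yields G s w \<Longrightarrow> yields G (X # s) (X # w)"
| expand: "(X, \<gamma>) \<in> productions G \<Longrightarrow> yields G \<gamma> w \<Longrightarrow> yields G s w' \<Longrightarrow> yields G (X # s) (w @ w')"

lemma yields_refl: "yields G w w"
  by (induction w) (auto intro: yields.intros)

lemma yields_append: "yields G v v' \<Longrightarrow> yields G w w' \<Longrightarrow> yields G (v @ w) (v' @ w')"
proof (induction rule: yields.induct)
  case (expand X \<gamma> u s u')
  then show ?case using yields.expand[of X \<gamma> G u "s @ w" "u' @ w'"] by simp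
qed (auto intro: yields.intros)

lemma yields_appendD:
  "yields G (a @ b) w \<Longrightarrow> \<exists>w1 w2. w = w1 @ w2 \<and> yields G a w1 \<and> yields G b w2"
proof (induction a arbitrary: w)
  case Nil
  then show ?case by (auto intro: yields.intros)
next
  case (Cons X a)
  from Cons.prems have "yields G (X # a @ b) w" by simp
  then show ?case
  proof cases
    case (keep w')
    then obtain w1 w2 where "w' = w1 @ w2" "yields G a w1" "yields G b w2"
      using Cons.IH by blast
    then show ?thesis
      using keep by (intro exI[of _ "X # w1"] exI[of _ w2]) (auto intro: yields.intros)
  next
    case (expand \<gamma> u u')
    then obtain w1 w2 where "u' = w1 @ w2" "yields G a w1" "yields G b w2"
      using Cons.IH by blast
    then show ?thesis
      using expand by (intro exI[of _ "u @ w1"] exI[of _ w2]) (auto intro: yields.intros)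
  qed
qed

lemma derives1_yields:
  assumes "derives1 G u v" and "yields G v w" shows "yields G u w"
proof -
  from assms(1) obtain x N y \<gamma> where
    *: "u = x @ [N] @ y" "v = x @ \<gamma> @ y" "(N, \<gamma>) \<in> productions G"
    unfolding derives1_def by blast
  with assms(2) obtain w1 w2 w3 where "w = w1 @ w2 @ w3" "yields G x w1" "yields G \<gamma> w2" "yields G y w3"
    by (metis yields_appendD)
  with * show ?thesis by (auto intro: yields_append yields.expand)
qed

lemma derives_yields: "derives G v w \<Longrightarrow> yields G v w"
  unfolding derives_def
  by (induction rule: converse_rtranclp_induct) (auto intro: yields_refl derives1_yields)


section \<open>Paths as admissible token sequences\<close>

abbreviation path_length :: "('a, 'c) path \<Rightarrow> nat" where
  "path_length p \<equiv> length (path_chars p)"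

lemma path_chars_simps [simp]:
  "path_chars [] = []" "path_chars (x # p) = snd x @ path_chars p"
  "path_chars (p @ q) = path_chars p @ path_chars q"
  by (simp_all add: path_chars_def)

lemma path_terminals_simps [simp]:
  "path_terminals [] = []" "path_terminals (x # p) = fst x # path_terminals p"
  "path_terminals (p @ q) = path_terminals p @ path_terminals q"
  "path_terminals p = [] \<longleftrightarrow> p = []"
  by (simp_all add: path_terminals_def)

text \<open>\<open>Z l\<close> holds the tokens available at position \<open>l\<close>, and
  \<open>j\<close> is where the path starts. Only the starting positions of tokens are constrained,
  so the last token may reach past the positions treated so far.\<close>

fun admissible :: "(nat \<Rightarrow> ('a, 'c) token set) \<Rightarrow> nat \<Rightarrow> ('a, 'c) path \<Rightarrow> bool" where
  "admissible Z j [] \<longleftrightarrow> True"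
| "admissible Z j (x # p) \<longleftrightarrow> x \<in> Z j \<and> admissible Z (j + length (snd x)) p"

lemma admissible_append [simp]:
  "admissible Z j (p @ q) \<longleftrightarrow> admissible Z j p \<and> admissible Z (j + path_length p) q"
  by (induction p arbitrary: j) (auto simp: add.assoc)

lemma admissible_mono: "admissible Z j p \<Longrightarrow> (\<And>l. Z l \<subseteq> Z' l) \<Longrightarrow> admissible Z' j p"
  by (induction p arbitrary: j) auto

lemma admissible_terminals:
  "admissible Z j p \<Longrightarrow> (\<And>l x. x \<in> Z l \<Longrightarrow> fst x \<in> A) \<Longrightarrow> path_terminals p \<in> lists A"
  by (induction p arbitrary: j) auto

definition admissible_paths ::
  "('a, 'c) local_lexing \<Rightarrow> (nat \<Rightarrow> ('a, 'c) token set) \<Rightarrow> ('a, 'c) path set" where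
  "admissible_paths G Z = {p. path_terminals p \<in> language_prefix G \<and> admissible Z 0 p}"

lemma language_prefix_appendD: "v @ w \<in> language_prefix G \<Longrightarrow> v \<in> language_prefix G"
proof -
  assume "v @ w \<in> language_prefix G"
  then obtain u where "v @ w \<in> lists (terminals G)" "u \<in> lists (nonterminals G \<union> terminals G)"
    "derives G [start_symbol G] (v @ w @ u)"
    unfolding language_prefix_def by auto
  moreover from this have "w @ u \<in> lists (nonterminals G \<union> terminals G)" by auto
  ultimately show ?thesis unfolding language_prefix_def by (auto intro!: bexI[of _ "w @ u"])
qed

section \<open>Limits of iterated operators, and one stage of appending tokens\<close>

lemma funpow_subset:
  assumes "\<And>X. X \<subseteq> f X" shows "m \<le> n \<Longrightarrow> (f ^^ m) X \<subseteq> (f ^^ n) X"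
  by (induction n) (use assms in \<open>force simp: le_Suc_eq\<close>)+

lemma subset_limit: "X \<subseteq> limit f X"
  unfolding limit_def using UN_upper[of 0 UNIV "\<lambda>n. (f ^^ n) X"] by simp

lemma limit_subset:
  assumes "X \<subseteq> Y" and "\<And>Z. Z \<subseteq> Y \<Longrightarrow> f Z \<subseteq> Y" shows "limit f X \<subseteq> Y"
proof -
  have "(f ^^ n) X \<subseteq> Y" for n by (induction n) (use assms in auto)
  then show ?thesis unfolding limit_def by auto
qed

text \<open>Nothing can follow once position \<open>k\<close> is passed, so in every admissible path
  the tokens starting at \<open>k\<close> come last. Appending at \<open>k\<close> alone therefore
  reaches all paths that the larger set \<open>T\<close> permits.\<close>

lemma limit_Append:
  assumes "Z k \<subseteq> T" and "\<And>l. l > k \<Longrightarrow> Z l = {}"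
  shows "limit (Append G T k) (admissible_paths G Z) = admissible_paths G (Z(k := T))" (is "?A = ?B")
proof
  show "?A \<subseteq> ?B"
  proof (rule limit_subset)
    show "admissible_paths G Z \<subseteq> ?B"
      using assms(1) unfolding admissible_paths_def by (auto elim!: admissible_mono)
    show "Append G T k P \<subseteq> ?B" if "P \<subseteq> ?B" for P
      using that unfolding Append_def admissible_paths_def by auto
  qed
  have "p \<in> ?A" if "path_terminals p \<in> language_prefix G" "admissible (Z(k := T)) 0 p" for p
    using that
  proof (induction p rule: rev_induct)
    case Nil
    then show ?case using subset_limit unfolding admissible_paths_def by fastforce
  next
    case (snoc x p)
    then have p: "path_terminals p \<in> language_prefix G" "admissible (Z(k := T)) 0 p"
      and x: "x \<in> (Z(k := T)) (path_length p)"
      by (auto dest: language_prefix_appendD simp del: fun_upd_apply)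
    from snoc.IH[OF p] obtain n where n: "p \<in> (Append G T k ^^ n) (admissible_paths G Z)"
      unfolding limit_def by blast
    show ?case
    proof (cases "path_length p = k")
      case True
      with x n snoc.prems have "p @ [x] \<in> (Append G T k ^^ Suc n) (admissible_paths G Z)"
        by (cases x) (auto simp: Append_def)
      then show ?thesis unfolding limit_def by blast
    next
      \<comment> \<open>The last token starts before \<open>k\<close>, hence so do all earlier ones,
        and the whole path is admissible for the old family.\<close>
      case False
      with x assms(2) have "path_length p < k"
        by (metis empty_iff fun_upd_other linorder_neqE_nat)
      moreover have "admissible Z j q" if "admissible (Z(k := T)) j q" "j + path_length q < k" for j q
        using that by (induction q arbitrary: j) (auto simp: add.assoc split: if_splits)
      ultimately have "admissible Z 0 p" using p(2) by (metis add_0)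
      with x False snoc.prems(1) have "p @ [x] \<in> admissible_paths G Z"
        by (simp add: admissible_paths_def)
      then show ?thesis by (rule subsetD[OF subset_limit])
    qed
  qed
  then show "?B \<subseteq> ?A" unfolding admissible_paths_def by auto
qed

section \<open>The induced grammar\<close>

lemma length_rule [simp]:
  "length (rule_syms r) = rule_len r" "length (rule_funs r) = Suc (rule_len r)"
  by (simp_all add: rule_syms_def rule_funs_def rule_len_def)

lemma param_seqs_length: "\<rho> \<in> param_seqs \<Phi> fs \<Longrightarrow> length \<rho> = 2 * length fs"
  by (simp add: param_seqs_def)

lemma param_seqs_nth_mem: "\<rho> \<in> param_seqs \<Phi> fs \<Longrightarrow> n < 2 * length fs \<Longrightarrow> \<rho> ! n \<in> \<Phi>"
  by (auto simp: param_seqs_def in_lists_conv_set)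

lemma param_seqs_Suc:
  assumes "d < length fs" and "\<rho> \<in> param_seqs \<Phi> (take d fs)" and "\<beta> \<in> \<Phi>" and "\<gamma> \<in> \<Phi>"
    and "(fs ! d) (\<rho> @ [\<beta>]) = Some \<gamma>"
  shows "\<rho> @ [\<beta>, \<gamma>] \<in> param_seqs \<Phi> (take (Suc d) fs)"
proof -
  have len: "length \<rho> = 2 * d" using assms param_seqs_length by force
  have "((take (Suc d) fs) ! i) (take (2 * i + 1) (\<rho> @ [\<beta>, \<gamma>])) = Some ((\<rho> @ [\<beta>, \<gamma>]) ! (2 * i + 1))"
    if "i < Suc d" for i
  proof (cases "i = d")
    case True
    then show ?thesis using assms len by (simp add: nth_append)
  next
    case False
    with that have "i < d" by simp
    with assms len show ?thesis by (auto simp: param_seqs_def nth_append)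
  qed
  with assms len show ?thesis by (auto simp: param_seqs_def)
qed

text \<open>The tail \<open>\<rho>'\<close> covers two situations: it is empty when the next
  function is undefined at \<open>\<rho> @ [\<beta>]\<close>, and it holds the value of that
  function when the dot moves on.\<close>

lemma annotate_take_Suc:
  assumes "d < length Xs" and "length \<rho> = 2 * d + 2"
  shows "annotate (take (Suc d) Xs) (\<rho> @ \<beta> # \<rho>') =
    annotate (take d Xs) \<rho> @ [Sym (Xs ! d) (\<rho> ! (2 * d + 1)) \<beta>]"
  using assms by (auto simp: annotate_def nth_append)

lemma induced_sel [simp]:
  "nonterminals (induced L) =
    {Sym N \<alpha> \<beta> | N \<alpha> \<beta>. N \<in> Nonterms L \<and> \<alpha> \<in> Params L \<and> \<beta> \<in> Params L} \<union> {Top, Bot}"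
  "terminals (induced L) = {Sym t \<alpha> \<beta> | t \<alpha> \<beta>. t \<in> Terms L \<and> \<alpha> \<in> Params L \<and> \<beta> \<in> Params L}"
  "productions (induced L) = induced_productions L"
  "start_symbol (induced L) = Top"
  "lexer (induced L) = induced_lexer L"
  "selector (induced L) = induced_selector L"
  by (simp_all add: induced_def)

lemma inj_induced_token: "inj induced_token"
  by (auto intro!: injI elim!: induced_token.elims)

lemma induced_token_mem_image [simp]:
  "(Sym t \<alpha> \<beta>, c) \<in> induced_token ` T \<longleftrightarrow> (t, \<alpha>, \<beta>, c) \<in> T"
  using inj_image_mem_iff[OF inj_induced_token, of "(t, \<alpha>, \<beta>, c)" T] by simp

text \<open>
  \<open>rest r d \<rho> s b\<close>: an induced production of \<open>r\<close> that agrees with \<open>\<rho>\<close> up to the dot position \<open>d\<close> may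
  continue with \<open>s\<close> after the dot, and \<open>b\<close> is the output parameter of its left side.
\<close>

inductive rest :: "('p, 's) rule \<Rightarrow> nat \<Rightarrow> 'p list \<Rightarrow> ('p, 's) isym list \<Rightarrow> 'p \<Rightarrow> bool" for r where
  finished: "rest r (rule_len r) \<rho> [] (\<rho> ! (2 * rule_len r + 1))"
| step: "d < rule_len r \<Longrightarrow> (rule_funs r ! Suc d) (\<rho> @ [\<beta>]) = Some \<gamma> \<Longrightarrow>
    rest r (Suc d) (\<rho> @ [\<beta>, \<gamma>]) s b \<Longrightarrow>
    rest r d \<rho> (Sym (rule_syms r ! d) (\<rho> ! (2 * d + 1)) \<beta> # s) b"
| stuck: "d < rule_len r \<Longrightarrow> rest r d \<rho> [Sym (rule_syms r ! d) (\<rho> ! (2 * d + 1)) \<beta>, Bot] b"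

lemma take_add_2: "Suc n < length xs \<Longrightarrow> take (Suc (Suc n)) xs = take n xs @ [xs ! n, xs ! Suc n]"
  by (simp add: take_Suc_conv_app_nth)


text \<open>Here \<open>take (2 * d + 2) \<rho>\<close> is the parameter sequence of an item with
  dot position \<open>d\<close>. The induction runs downwards because \<open>rest\<close> is built
  from the end of the right side.\<close>

lemma rest_full:
  assumes "\<rho> \<in> param_seqs \<Phi> (rule_funs r)" and "d \<le> rule_len r"
  shows "rest r d (take (2 * d + 2) \<rho>) (drop d (annotate (rule_syms r) \<rho>)) (\<rho> ! (2 * rule_len r + 1))"
  using assms(2)
proof (induction d rule: inc_induct)
  case base
  show ?case using assms rest.finished[of r \<rho>] param_seqs_length[OF assms(1)]
    by (simp add: annotate_def)
next
  case (step d)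
  let ?\<tau> = "take (2 * d + 2) \<rho>"
  have len: "length \<rho> = 2 * rule_len r + 2" using param_seqs_length[OF assms(1)] by simp
  have t: "take (2 * Suc d + 2) \<rho> = ?\<tau> @ [\<rho> ! (2 * d + 2), \<rho> ! (2 * d + 3)]"
    using take_add_2[of "2 * d + 2" \<rho>] len step.hyps by (simp add: eval_nat_numeral)
  have t1: "take (2 * Suc d + 1) \<rho> = ?\<tau> @ [\<rho> ! (2 * d + 2)]"
    using take_Suc_conv_app_nth[of "2 * d + 2" \<rho>] len step.hyps by simp
  have "(rule_funs r ! Suc d) (take (2 * Suc d + 1) \<rho>) = Some (\<rho> ! (2 * Suc d + 1))"
    using assms(1) step.hyps by (auto simp: param_seqs_def)
  then have f: "(rule_funs r ! Suc d) (?\<tau> @ [\<rho> ! (2 * d + 2)]) = Some (\<rho> ! (2 * d + 3))"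
    unfolding t1 by (simp add: eval_nat_numeral)
  have "drop d (annotate (rule_syms r) \<rho>) = Sym (rule_syms r ! d) (?\<tau> ! (2 * d + 1)) (\<rho> ! (2 * d + 2))
      # drop (Suc d) (annotate (rule_syms r) \<rho>)"
    using step.hyps len by (simp add: Cons_nth_drop_Suc[symmetric] annotate_def)
  with rest.step[OF step.hyps(2) f] step.IH show ?case unfolding t by simp
qed

text \<open>The downward induction starts at \<open>h - 1\<close>: the last symbol before
  \<open>Bot\<close> carries a guessed output parameter that enters no item, so \<open>stuck\<close>
  covers this symbol together with \<open>Bot\<close>.\<close>

lemma rest_partial:
  assumes "\<rho> \<in> param_seqs \<Phi> (take h (rule_funs r))" and "h \<le> rule_len r" and "d < h"
  shows "rest r d (take (2 * d + 2) \<rho>) (drop d (annotate (take h (rule_syms r)) (\<rho> @ [\<beta>])) @ [Bot]) b"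
proof -
  have len: "length \<rho> = 2 * h" using param_seqs_length[OF assms(1)] assms(2) by simp
  have drop: "drop d (annotate (take h (rule_syms r)) (\<rho> @ [\<beta>])) =
      Sym (rule_syms r ! d) (take (2 * d + 2) \<rho> ! (2 * d + 1)) ((\<rho> @ [\<beta>]) ! (2 * d + 2))
      # drop (Suc d) (annotate (take h (rule_syms r)) (\<rho> @ [\<beta>]))" if "d < h" for d
    using assms(2) len that
    by (simp add: Cons_nth_drop_Suc[symmetric] annotate_def nth_append)
  from assms(3) have "d \<le> h - 1" by simp
  then show ?thesis
  proof (induction d rule: inc_induct)
    case base
    have "Suc (h - 1) = h" using assms(3) by simp
    with assms len show ?case
      using rest.stuck[of "h - 1" r "take (2 * (h - 1) + 2) \<rho>"] drop[of "h - 1"]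
      by (simp add: annotate_def)
  next
    case (step d)
    let ?\<tau> = "take (2 * d + 2) \<rho>"
    have d: "Suc d < h" "d < rule_len r" using step.hyps assms by auto
    have t: "take (2 * Suc d + 2) \<rho> = ?\<tau> @ [\<rho> ! (2 * d + 2), \<rho> ! (2 * d + 3)]"
      using take_add_2[of "2 * d + 2" \<rho>] len d by (simp add: eval_nat_numeral)
    have t1: "take (2 * Suc d + 1) \<rho> = ?\<tau> @ [\<rho> ! (2 * d + 2)]"
      using take_Suc_conv_app_nth[of "2 * d + 2" \<rho>] len d by simp
    have "(rule_funs r ! Suc d) (take (2 * Suc d + 1) \<rho>) = Some (\<rho> ! (2 * Suc d + 1))"
      using assms d by (auto simp: param_seqs_def)
    then have f: "(rule_funs r ! Suc d) (?\<tau> @ [\<rho> ! (2 * d + 2)]) = Some (\<rho> ! (2 * d + 3))"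
      unfolding t1 by (simp add: eval_nat_numeral)
    have "(\<rho> @ [\<beta>]) ! (2 * d + 2) = \<rho> ! (2 * d + 2)" using d len by (simp add: nth_append)
    with rest.step[OF d(2) f] step.IH drop[of d] d show ?case unfolding t by simp
  qed
qed

section \<open>Soundness of items\<close>

text \<open>
  The output parameter of the left side is unknown until the item is completed. Hence the context must
  admit all of them.
\<close>

definition valid_items ::
  "('p, 's, 'c) pll \<Rightarrow> (nat \<Rightarrow> ('p, 's, 'c) ptoken set) \<Rightarrow> ('p, 's) item set" where
  "valid_items L T =
     {(r, d, i, j, \<rho>). r \<in> Rules L \<and> d \<le> rule_len r \<and>
        \<rho> \<in> param_seqs (Params L) (take (Suc d) (rule_funs r)) \<and>
        (\<exists>p q. admissible (\<lambda>l. induced_token ` T l) 0 p \<and> path_length p = i \<and>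
           admissible (\<lambda>l. induced_token ` T l) i q \<and> j = i + path_length q \<and>
           (\<forall>\<beta> \<in> Params L. \<exists>v. derives (induced L) [Top]
              (path_terminals p @ Sym (lhs r) (\<rho> ! 0) \<beta> # v)) \<and>
           derives (induced L) (annotate (take d (rule_syms r)) \<rho>) (path_terminals q))}"

lemma valid_itemsI:
  assumes "r \<in> Rules L" and "d \<le> rule_len r"
    and "\<rho> \<in> param_seqs (Params L) (take (Suc d) (rule_funs r))"
    and "admissible (\<lambda>l. induced_token ` T l) 0 p" and "path_length p = i"
    and "admissible (\<lambda>l. induced_token ` T l) i q" and "j = i + path_length q"
    and "\<And>\<beta>. \<beta> \<in> Params L \<Longrightarrow> \<exists>v. derives (induced L) [Top]
           (path_terminals p @ Sym (lhs r) (\<rho> ! 0) \<beta> # v)"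
    and "derives (induced L) (annotate (take d (rule_syms r)) \<rho>) (path_terminals q)"
  shows "(r, d, i, j, \<rho>) \<in> valid_items L T"
  using assms unfolding valid_items_def by blast

lemma valid_items_mono:
  assumes "\<And>l. T l \<subseteq> T' l" shows "valid_items L T \<subseteq> valid_items L T'"
proof -
  have *: "admissible (\<lambda>l. induced_token ` T l) j p \<Longrightarrow> admissible (\<lambda>l. induced_token ` T' l) j p" for j p
    by (erule admissible_mono) (use assms in auto)
  show ?thesis
  proof
    fix x assume "x \<in> valid_items L T"
    then obtain r d i j \<rho> p q where x: "x = (r, d, i, j, \<rho>)" and
      "r \<in> Rules L" "d \<le> rule_len r" "\<rho> \<in> param_seqs (Params L) (take (Suc d) (rule_funs r))"
      "admissible (\<lambda>l. induced_token ` T l) 0 p" "path_length p = i"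
      "admissible (\<lambda>l. induced_token ` T l) i q" "j = i + path_length q"
      "\<forall>\<beta> \<in> Params L. \<exists>v. derives (induced L) [Top] (path_terminals p @ Sym (lhs r) (\<rho> ! 0) \<beta> # v)"
      "derives (induced L) (annotate (take d (rule_syms r)) \<rho>) (path_terminals q)"
      unfolding valid_items_def by auto
    then have "(r, d, i, j, \<rho>) \<in> valid_items L T'"
      by (intro valid_itemsI[where p = p and q = q]) (simp_all add: *)
    then show "x \<in> valid_items L T'" unfolding x .
  qed
qed

section \<open>Introduction and case rules for the item operations\<close>

lemma PredictI:
  assumes "(r, d, i, k, \<rho>) \<in> I" and "d < rule_len r"
    and "r' \<in> Rules L" and "lhs r' = rule_syms r ! d"
    and "(rule_funs r' ! 0) [\<rho> ! (2 * d + 1)] = Some \<gamma>"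
  shows "(r', 0, k, k, [\<rho> ! (2 * d + 1), \<gamma>]) \<in> Predict L k I"
  unfolding Predict_def using assms by blast

lemma CompleteI:
  assumes "(r, d, i, j, \<rho>) \<in> I" and "d < rule_len r" and "(r', rule_len r', j, k, \<xi>) \<in> I"
    and "lhs r' = rule_syms r ! d" and "\<rho> ! (2 * d + 1) = \<xi> ! 0"
    and "(rule_funs r ! Suc d) (\<rho> @ [\<xi> ! (2 * rule_len r' + 1)]) = Some \<gamma>"
  shows "(r, Suc d, i, k, \<rho> @ [\<xi> ! (2 * rule_len r' + 1), \<gamma>]) \<in> Complete k I"
  unfolding Complete_def
  by (rule UnI2, rule CollectI, rule exI[of _ r], rule exI[of _ d], rule exI[of _ i], rule exI[of _ j],
      rule exI[of _ \<rho>], rule exI[of _ r'], rule exI[of _ "rule_len r'"], rule exI[of _ \<xi>],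
      rule exI, rule exI[of _ \<gamma>]) (use assms in simp)

lemma ScanI:
  assumes "(r, d, i, k, \<rho>) \<in> I" and "d < rule_len r"
    and "(rule_syms r ! d, \<rho> ! (2 * d + 1), \<beta>, c) \<in> U"
    and "(rule_funs r ! Suc d) (\<rho> @ [\<beta>]) = Some \<gamma>"
  shows "(r, Suc d, i, k + length c, \<rho> @ [\<beta>, \<gamma>]) \<in> Scan U k I"
  unfolding Scan_def
  by (rule UnI2, rule CollectI, rule exI[of _ r], rule exI[of _ d], rule exI[of _ i], rule exI[of _ \<rho>],
      rule exI[of _ \<beta>], rule exI[of _ c], rule exI, rule exI[of _ \<gamma>]) (use assms in simp)

lemma Predict_cases:
  assumes "x \<in> Predict L k I"
  obtains "x \<in> I"
  | r d i \<rho> r' \<gamma> where "x = (r', 0, k, k, [\<rho> ! (2 * d + 1), \<gamma>])"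
    and "(r, d, i, k, \<rho>) \<in> I" and "d < rule_len r" and "r' \<in> Rules L" and "lhs r' = rule_syms r ! d"
    and "(rule_funs r' ! 0) [\<rho> ! (2 * d + 1)] = Some \<gamma>"
  using assms unfolding Predict_def by blast

lemma Complete_cases:
  assumes "x \<in> Complete k I"
  obtains "x \<in> I"
  | r d i j \<rho> r' \<xi> \<gamma> where "x = (r, Suc d, i, k, \<rho> @ [\<xi> ! (2 * rule_len r' + 1), \<gamma>])"
    and "(r, d, i, j, \<rho>) \<in> I" and "d < rule_len r" and "(r', rule_len r', j, k, \<xi>) \<in> I"
    and "lhs r' = rule_syms r ! d" and "\<rho> ! (2 * d + 1) = \<xi> ! 0"
    and "(rule_funs r ! Suc d) (\<rho> @ [\<xi> ! (2 * rule_len r' + 1)]) = Some \<gamma>"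
  using assms unfolding Complete_def
proof (elim UnE CollectE exE conjE, goal_cases)
  case (2 r d i j \<rho> r' u \<xi> \<rho>' \<gamma>)
  show ?case by (rule 2(2)[of r d i \<rho> \<xi> r' \<gamma> j]) (use 2(3-) in simp_all)
qed

lemma Scan_cases:
  assumes "x \<in> Scan U k I"
  obtains "x \<in> I"
  | r d i \<rho> \<beta> c \<gamma> where "x = (r, Suc d, i, k + length c, \<rho> @ [\<beta>, \<gamma>])"
    and "(r, d, i, k, \<rho>) \<in> I" and "d < rule_len r"
    and "(rule_syms r ! d, \<rho> ! (2 * d + 1), \<beta>, c) \<in> U"
    and "(rule_funs r ! Suc d) (\<rho> @ [\<beta>]) = Some \<gamma>"
  using assms unfolding Scan_def
proof (elim UnE CollectE exE conjE, goal_cases)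
  case (2 r d i \<rho> \<beta> c \<rho>' \<gamma>)
  show ?case by (rule 2(2)[of r d i c \<rho> \<beta> \<gamma>]) (use 2(3-) in simp_all)
qed

context parameterized_local_lexing
begin

lemma rule_fun_Some_mem: "r \<in> Rules L \<Longrightarrow> i \<le> rule_len r \<Longrightarrow> (rule_funs r ! i) xs = Some \<gamma> \<Longrightarrow> \<gamma> \<in> Params L"
  using rule_ran by (blast intro: ranI)

lemma param_seqs_singleton:
  assumes "r \<in> Rules L" and "\<alpha> \<in> Params L" and "(rule_funs r ! 0) [\<alpha>] = Some \<gamma>"
  shows "[\<alpha>, \<gamma>] \<in> param_seqs (Params L) (take (Suc 0) (rule_funs r))"
proof -
  have "[] \<in> param_seqs (Params L) (take 0 (rule_funs r))" by (simp add: param_seqs_def)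
  from param_seqs_Suc[OF _ this assms(2) rule_fun_Some_mem[OF assms(1) _ assms(3)]] assms(3)
  show ?thesis by simp
qed

lemma production_full:
  assumes "r \<in> Rules L" and "\<rho> \<in> param_seqs (Params L) (rule_funs r)"
  shows "(Sym (lhs r) (\<rho> ! 0) (\<rho> ! (2 * rule_len r + 1)), annotate (rule_syms r) \<rho>)
    \<in> induced_productions L"
  using assms unfolding induced_productions_def by blast

lemma production_partial:
  assumes "r \<in> Rules L" and "1 \<le> h" and "h \<le> rule_len r" and "b \<in> Params L" and "\<beta> \<in> Params L"
    and "\<rho> \<in> param_seqs (Params L) (take h (rule_funs r))" and "(rule_funs r ! h) (\<rho> @ [\<beta>]) = None"
  shows "(Sym (lhs r) (\<rho> ! 0) b, annotate (take h (rule_syms r)) (\<rho> @ [\<beta>]) @ [Bot])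
    \<in> induced_productions L"
  using assms unfolding induced_productions_def by blast

text \<open>
  The parameters after the dot are free, so they are chosen as the functions of the rule prescribe,
  until the rule is exhausted or a function is undefined and \<open>Bot\<close> takes over.
\<close>

lemma production_extension:
  assumes "r \<in> Rules L" and "d < rule_len r" and "\<beta> \<in> Params L"
    and "\<rho> \<in> param_seqs (Params L) (take (Suc d) (rule_funs r))"
  shows "\<exists>b \<in> Params L. \<exists>s. (Sym (lhs r) (\<rho> ! 0) b,
    annotate (take d (rule_syms r)) \<rho> @ Sym (rule_syms r ! d) (\<rho> ! (2 * d + 1)) \<beta> # s)
    \<in> induced_productions L"
  using assms(2,4)
proof (induction "rule_len r - d" arbitrary: d \<rho>)
  case 0
  then show ?case by simp
next
  case (Suc n)
  have len: "length \<rho> = 2 * d + 2" using param_seqs_length[OF Suc.prems(2)] Suc.prems(1) by simp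
  have nth: "(\<rho> @ xs) ! 0 = \<rho> ! 0" for xs using len by (simp add: nth_append)
  have ann: "annotate (take (Suc d) (rule_syms r)) (\<rho> @ \<beta> # xs) =
      annotate (take d (rule_syms r)) \<rho> @ [Sym (rule_syms r ! d) (\<rho> ! (2 * d + 1)) \<beta>]" for xs
    using Suc.prems(1) len by (intro annotate_take_Suc) auto
  show ?case
  proof (cases "(rule_funs r ! Suc d) (\<rho> @ [\<beta>])")
    case None
    \<comment> \<open>The left side of a production with \<open>Bot\<close> may have any output
      parameter, so \<open>\<beta>\<close> serves as \<open>b\<close> too.\<close>
    from production_partial[OF assms(1) _ _ assms(3,3) Suc.prems(2) None] Suc.prems(1) assms(3)
    show ?thesis by (auto simp: ann)
  next
    case (Some \<gamma>)
    have \<gamma>: "\<gamma> \<in> Params L" using rule_fun_Some_mem[OF assms(1) _ Some] Suc.prems(1) by simp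
    have \<rho>': "\<rho> @ [\<beta>, \<gamma>] \<in> param_seqs (Params L) (take (Suc (Suc d)) (rule_funs r))"
      using param_seqs_Suc[OF _ Suc.prems(2) assms(3) \<gamma> Some] Suc.prems(1) by simp
    show ?thesis
    proof (cases "Suc d = rule_len r")
      case True
      with \<rho>' have "\<rho> @ [\<beta>, \<gamma>] \<in> param_seqs (Params L) (rule_funs r)" by simp
      from production_full[OF assms(1) this] param_seqs_nth_mem[OF this, of "2 * rule_len r + 1"]
      have "(Sym (lhs r) (\<rho> ! 0) ((\<rho> @ [\<beta>, \<gamma>]) ! (2 * rule_len r + 1)),
          annotate (rule_syms r) (\<rho> @ [\<beta>, \<gamma>])) \<in> induced_productions L"
        and "(\<rho> @ [\<beta>, \<gamma>]) ! (2 * rule_len r + 1) \<in> Params L"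
        by (simp_all add: nth)
      moreover have "annotate (rule_syms r) (\<rho> @ [\<beta>, \<gamma>]) =
          annotate (take d (rule_syms r)) \<rho> @ [Sym (rule_syms r ! d) (\<rho> ! (2 * d + 1)) \<beta>]"
        using ann[of "[\<gamma>]"] True by simp
      ultimately show ?thesis by auto
    next
      case False
      \<comment> \<open>The induction hypothesis keeps \<open>\<beta>\<close>, which is thus guessed
        again as the output parameter of the next symbol.\<close>
      with Suc.prems have "Suc d < rule_len r" by simp
      moreover have "n = rule_len r - Suc d" using Suc.hyps(2) by simp
      ultimately show ?thesis using Suc.hyps(1)[OF _ _ \<rho>'] by (auto simp: ann nth)
    qed
  qed
qed

abbreviation "carrier \<equiv> nonterminals (induced L) \<union> terminals (induced L)"

lemma annotate_carrier:
  assumes "set Xs \<subseteq> Nonterms L \<union> Terms L" and "set \<rho> \<subseteq> Params L" and "2 * length Xs < length \<rho>"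
  shows "set (annotate Xs \<rho>) \<subseteq> carrier"
proof -
  have "Xs ! i \<in> Nonterms L \<union> Terms L \<and> \<rho> ! (2 * i + 1) \<in> Params L \<and> \<rho> ! (2 * i + 2) \<in> Params L"
    if "i < length Xs" for i
    using that assms(3) by (intro conjI subsetD[OF assms(1) nth_mem] subsetD[OF assms(2) nth_mem]) auto
  then show ?thesis unfolding annotate_def by fastforce
qed

lemma production_carrier:
  assumes "(X, \<gamma>) \<in> induced_productions L" shows "set \<gamma> \<subseteq> carrier"
  using assms unfolding induced_productions_def
proof (elim UnE CollectE exE conjE)
  fix \<beta> assume "(X, \<gamma>) = (Top, [Sym (Start L) (start_param L) \<beta>])" "\<beta> \<in> Params L"
  then show ?thesis using start_nonterm start_param by auto
next
  fix r \<rho>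
  assume "(X, \<gamma>) = (Sym (lhs r) (\<rho> ! 0) (\<rho> ! (2 * rule_len r + 1)), annotate (rule_syms r) \<rho>)"
    and r: "r \<in> Rules L" and \<rho>: "\<rho> \<in> param_seqs (Params L) (rule_funs r)"
  moreover have "set \<rho> \<subseteq> Params L" using \<rho> by (auto simp: param_seqs_def)
  ultimately show ?thesis
    using annotate_carrier[OF rule_rhs[OF r], of \<rho>] param_seqs_length[OF \<rho>] by simp
next
  fix r h \<rho> \<beta> \<beta>h
  assume X: "(X, \<gamma>) = (Sym (lhs r) (\<rho> ! 0) \<beta>, annotate (take h (rule_syms r)) (\<rho> @ [\<beta>h]) @ [Bot])"
    and r: "r \<in> Rules L" "h \<le> rule_len r" "\<beta>h \<in> Params L"
    and \<rho>: "\<rho> \<in> param_seqs (Params L) (take h (rule_funs r))"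
  have "set (take h (rule_syms r)) \<subseteq> Nonterms L \<union> Terms L"
    using rule_rhs[OF r(1)] set_take_subset by fastforce
  moreover have "set (\<rho> @ [\<beta>h]) \<subseteq> Params L" using \<rho> r by (auto simp: param_seqs_def)
  ultimately show ?thesis
    using annotate_carrier[of "take h (rule_syms r)" "\<rho> @ [\<beta>h]"] X r param_seqs_length[OF \<rho>]
    by simp
qed

text \<open>Discharges the demand of \<open>language_prefix\<close> that the remainder be made of
  symbols of the grammar.\<close>

lemma derives_carrier:
  assumes "derives (induced L) [Top] w" shows "set w \<subseteq> carrier"
  using assms unfolding derives_def
proof (induction rule: rtranclp_induct)
  case base
  show ?case by simp
next
  case (step v w)
  from step.hyps(2) obtain x N y \<gamma> where "v = x @ [N] @ y" "w = x @ \<gamma> @ y"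
    and "(N, \<gamma>) \<in> induced_productions L"
    unfolding derives1_def by auto
  with production_carrier step.IH show ?case by (simp del: induced_sel(1,2))
qed

text \<open>Moves the context from the left side of the item to the symbol after its dot. The
  extending production dictates the output parameter \<open>b\<close> of the left side; the context
  accepts it because validity admits all of them.\<close>

lemma valid_items_next:
  assumes "(r, d, i, j, \<rho>) \<in> valid_items L T" and "d < rule_len r"
  obtains p where "admissible (\<lambda>l. induced_token ` T l) 0 p" and "path_length p = j"
    and "\<And>\<beta>. \<beta> \<in> Params L \<Longrightarrow> \<exists>v. derives (induced L) [Top]
           (path_terminals p @ Sym (rule_syms r ! d) (\<rho> ! (2 * d + 1)) \<beta> # v)"
proof -
  from assms obtain p q where r: "r \<in> Rules L" "\<rho> \<in> param_seqs (Params L) (take (Suc d) (rule_funs r))"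
    and pq: "admissible (\<lambda>l. induced_token ` T l) 0 p" "path_length p = i"
      "admissible (\<lambda>l. induced_token ` T l) i q" "j = i + path_length q"
    and p: "\<And>\<beta>. \<beta> \<in> Params L \<Longrightarrow> \<exists>v. derives (induced L) [Top]
              (path_terminals p @ Sym (lhs r) (\<rho> ! 0) \<beta> # v)"
    and q: "derives (induced L) (annotate (take d (rule_syms r)) \<rho>) (path_terminals q)"
    unfolding valid_items_def by auto
  have "\<exists>v. derives (induced L) [Top]
           (path_terminals (p @ q) @ Sym (rule_syms r ! d) (\<rho> ! (2 * d + 1)) \<beta> # v)"
    if \<beta>: "\<beta> \<in> Params L" for \<beta>
  proof -
    let ?X = "Sym (rule_syms r ! d) (\<rho> ! (2 * d + 1)) \<beta>"
    from production_extension[OF r(1) assms(2) \<beta> r(2)] obtain b s where b: "b \<in> Params L"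
      and "(Sym (lhs r) (\<rho> ! 0) b, annotate (take d (rule_syms r)) \<rho> @ ?X # s) \<in> productions (induced L)"
      by auto
    from derives_production[OF this(2)] have "derives (induced L) [Sym (lhs r) (\<rho> ! 0) b] (path_terminals q @ ?X # s)"
      using derives_append[OF q derives_refl] by (blast intro: derives_trans)
    from derives_context[OF this, of "path_terminals p"] p[OF b] show ?thesis
      by (fastforce intro: derives_trans)
  qed
  with pq that[of "p @ q"] show thesis by simp
qed

lemma Init_valid: "Init L \<subseteq> valid_items L T"
proof
  fix x assume "x \<in> Init L"
  then obtain r \<gamma> where x: "x = (r, 0, 0, 0, [start_param L, \<gamma>])" and r: "r \<in> Rules L" "lhs r = Start L"
    and \<gamma>: "(rule_funs r ! 0) [start_param L] = Some \<gamma>"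
    unfolding Init_def by auto
  have "derives (induced L) [Top] [Sym (Start L) (start_param L) \<beta>]" if "\<beta> \<in> Params L" for \<beta>
    using that by (intro derives_production) (auto simp: induced_productions_def)
  then show "x \<in> valid_items L T"
    using x r param_seqs_singleton[OF r(1) start_param \<gamma>]
    by (auto simp: valid_items_def annotate_def derives_refl intro!: exI[of _ "[]"])
qed

lemma Predict_valid:
  assumes I: "I \<subseteq> valid_items L T" shows "Predict L k I \<subseteq> valid_items L T"
proof
  fix x assume "x \<in> Predict L k I"
  then consider "x \<in> I" | r d i \<rho> r' \<gamma> where "x = (r', 0, k, k, [\<rho> ! (2 * d + 1), \<gamma>])"
    "(r, d, i, k, \<rho>) \<in> valid_items L T" "d < rule_len r" "r' \<in> Rules L" "lhs r' = rule_syms r ! d"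
    "(rule_funs r' ! 0) [\<rho> ! (2 * d + 1)] = Some \<gamma>"
    unfolding Predict_def using I by blast
  then show "x \<in> valid_items L T"
  proof cases
    case 1
    then show ?thesis using I by blast
  next
    case (2 r d i \<rho> r' \<gamma>)
    from 2 have "\<rho> ! (2 * d + 1) \<in> Params L"
      by (auto simp: valid_items_def intro: param_seqs_nth_mem)
    note \<rho>' = param_seqs_singleton[OF 2(4) this 2(6)]
    from valid_items_next[OF 2(2,3)] obtain p where
      "admissible (\<lambda>l. induced_token ` T l) 0 p" "path_length p = k"
      "\<And>\<beta>. \<beta> \<in> Params L \<Longrightarrow> \<exists>v. derives (induced L) [Top]
           (path_terminals p @ Sym (rule_syms r ! d) (\<rho> ! (2 * d + 1)) \<beta> # v)"
      by blast
    with 2(1,4,5) \<rho>' show ?thesis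
      by (simp only:) (rule valid_itemsI[where p = p and q = "[]"], auto simp: annotate_def derives_refl)
  qed
qed

text \<open>The common core of completion and scanning: \<open>q\<close> is the path parsed by the
  completed item, or a single token.\<close>

lemma valid_items_advance:
  assumes "(r, d, i, j, \<rho>) \<in> valid_items L T" and "d < rule_len r" and "\<beta> \<in> Params L"
    and "(rule_funs r ! Suc d) (\<rho> @ [\<beta>]) = Some \<gamma>"
    and "admissible (\<lambda>l. induced_token ` T l) j q"
    and "derives (induced L) [Sym (rule_syms r ! d) (\<rho> ! (2 * d + 1)) \<beta>] (path_terminals q)"
  shows "(r, Suc d, i, j + path_length q, \<rho> @ [\<beta>, \<gamma>]) \<in> valid_items L T"
proof -
  from assms(1) obtain p q' where r: "r \<in> Rules L" "\<rho> \<in> param_seqs (Params L) (take (Suc d) (rule_funs r))"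
    and pq: "admissible (\<lambda>l. induced_token ` T l) 0 p" "path_length p = i"
      "admissible (\<lambda>l. induced_token ` T l) i q'" "j = i + path_length q'"
    and p: "\<And>\<beta>. \<beta> \<in> Params L \<Longrightarrow> \<exists>v. derives (induced L) [Top]
              (path_terminals p @ Sym (lhs r) (\<rho> ! 0) \<beta> # v)"
    and q': "derives (induced L) (annotate (take d (rule_syms r)) \<rho>) (path_terminals q')"
    unfolding valid_items_def by auto
  have len: "length \<rho> = 2 * d + 2" using param_seqs_length[OF r(2)] assms(2) by simp
  have \<gamma>: "\<gamma> \<in> Params L" using rule_fun_Some_mem[OF r(1) _ assms(4)] assms(2) by simp
  have \<rho>': "\<rho> @ [\<beta>, \<gamma>] \<in> param_seqs (Params L) (take (Suc (Suc d)) (rule_funs r))"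
    using param_seqs_Suc[OF _ r(2) assms(3) \<gamma> assms(4)] assms(2) by simp
  have "annotate (take (Suc d) (rule_syms r)) (\<rho> @ [\<beta>, \<gamma>]) =
      annotate (take d (rule_syms r)) \<rho> @ [Sym (rule_syms r ! d) (\<rho> ! (2 * d + 1)) \<beta>]"
    using annotate_take_Suc[of d "rule_syms r" \<rho> \<beta> "[\<gamma>]"] assms(2) len by simp
  with derives_append[OF q' assms(6)]
  have "derives (induced L) (annotate (take (Suc d) (rule_syms r)) (\<rho> @ [\<beta>, \<gamma>])) (path_terminals (q' @ q))"
    by simp
  with r(1) assms(2,5) \<rho>' pq p len show ?thesis
    by (intro valid_itemsI[where p = p and q = "q' @ q"]) (auto simp: nth_append)
qed

lemma Complete_valid:
  assumes I: "I \<subseteq> valid_items L T" shows "Complete k I \<subseteq> valid_items L T"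
proof
  fix x assume "x \<in> Complete k I"
  then show "x \<in> valid_items L T"
  proof (cases rule: Complete_cases)
    case 1
    then show ?thesis using I by blast
  next
    case (2 r d i j \<rho> r' \<xi> \<gamma>)
    from 2(2,4) I have v: "(r, d, i, j, \<rho>) \<in> valid_items L T" "(r', rule_len r', j, k, \<xi>) \<in> valid_items L T"
      by auto
    from v(2) obtain q where r': "r' \<in> Rules L" and \<xi>: "\<xi> \<in> param_seqs (Params L) (rule_funs r')"
      and q: "admissible (\<lambda>l. induced_token ` T l) j q" "k = j + path_length q"
        "derives (induced L) (annotate (rule_syms r') \<xi>) (path_terminals q)"
      unfolding valid_items_def by auto
    have "\<xi> ! (2 * rule_len r' + 1) \<in> Params L" using \<xi> by (auto intro: param_seqs_nth_mem)
    moreover have "derives (induced L) [Sym (lhs r') (\<xi> ! 0) (\<xi> ! (2 * rule_len r' + 1))] (path_terminals q)"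
      using derives_trans[OF derives_production q(3)] production_full[OF r' \<xi>] by simp
    ultimately show ?thesis
      using valid_items_advance[OF v(1) 2(3) _ 2(7) q(1)] 2(1,5,6) q(2) by simp
  qed
qed

lemma Scan_valid:
  assumes I: "I \<subseteq> valid_items L T" and "U \<subseteq> T k" and "U \<subseteq> Terms L \<times> Params L \<times> Params L \<times> UNIV"
  shows "Scan U k I \<subseteq> valid_items L T"
proof
  fix x assume "x \<in> Scan U k I"
  then show "x \<in> valid_items L T"
  proof (cases rule: Scan_cases)
    case 1
    then show ?thesis using I by blast
  next
    case (2 r d i \<rho> \<beta> c \<gamma>)
    from 2(2) I have "(r, d, i, k, \<rho>) \<in> valid_items L T" by auto
    moreover have "(rule_syms r ! d, \<rho> ! (2 * d + 1), \<beta>, c) \<in> T k" "\<beta> \<in> Params L" using 2(4) assms by auto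
    ultimately show ?thesis
      using valid_items_advance[of r d i k \<rho> T \<beta> \<gamma> "[(Sym (rule_syms r ! d) (\<rho> ! (2 * d + 1)) \<beta>, c)]"] 2(1,3,5)
      by (simp add: derives_refl)
  qed
qed

lemma saturate_valid:
  assumes "I \<subseteq> valid_items L T" and "U \<subseteq> T k" and "U \<subseteq> Terms L \<times> Params L \<times> Params L \<times> UNIV"
  shows "saturate L k U I \<subseteq> valid_items L T"
  unfolding saturate_def
proof (rule limit_subset[OF assms(1)])
  fix I assume "I \<subseteq> valid_items L T"
  then have "Scan U k (Complete k (Predict L k I)) \<subseteq> valid_items L T"
    by (intro Scan_valid[where T = T, OF _ assms(2,3)] Complete_valid Predict_valid)
  then show "(Scan U k \<circ> Complete k \<circ> Predict L k) I \<subseteq> valid_items L T" by simp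
qed

end

section \<open>Completeness of closed item sets\<close>

text \<open>
  Here \<open>m\<close> is the position reached by a scanned path and \<open>v\<close> what remains of the derived form. If nothing
  remains, the rule \<open>r\<close> is completed; if a symbol for \<open>t\<close> comes first, some item expects \<open>t\<close>. One
  induction needs both, as the earlier siblings of the symbol that derives the first remaining symbol are
  completed.
\<close>

definition items_follow ::
  "('p, 's) item set \<Rightarrow> ('p, 's) rule \<Rightarrow> nat \<Rightarrow> 'p \<Rightarrow> 'p \<Rightarrow> nat \<Rightarrow> ('p, 's) isym list \<Rightarrow> bool" where
  "items_follow J r i a b m v \<longleftrightarrow>
     (v = [] \<longrightarrow> (\<exists>\<xi>. (r, rule_len r, i, m, \<xi>) \<in> J \<and> \<xi> ! 0 = a \<and> \<xi> ! (2 * rule_len r + 1) = b)) \<and>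
     (\<forall>t \<alpha> \<beta> v'. v = Sym t \<alpha> \<beta> # v' \<longrightarrow>
        (\<exists>r d i \<rho>. (r, d, i, m, \<rho>) \<in> J \<and> d < rule_len r \<and> rule_syms r ! d = t \<and> \<rho> ! (2 * d + 1) = \<alpha>))"

text \<open>All positions up to \<open>k\<close> are included because the inner nodes of a
  derivation tree for a path may start and end anywhere along it.\<close>

definition closed_items ::
  "('p, 's, 'c) pll \<Rightarrow> (nat \<Rightarrow> ('p, 's, 'c) ptoken set) \<Rightarrow> nat \<Rightarrow> ('p, 's) item set \<Rightarrow> bool" where
  "closed_items L T k J \<longleftrightarrow> Init L \<subseteq> J \<and>
     (\<forall>j \<le> k. Predict L j J \<subseteq> J \<and> Complete j J \<subseteq> J \<and> Scan (T j) j J \<subseteq> J)"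

lemma closed_items_Predict:
  assumes "closed_items L T k J" and "j \<le> k" and "(r, d, i, j, \<rho>) \<in> J" and "d < rule_len r"
    and "r' \<in> Rules L" and "lhs r' = rule_syms r ! d"
    and "(rule_funs r' ! 0) [\<rho> ! (2 * d + 1)] = Some \<gamma>"
  shows "(r', 0, j, j, [\<rho> ! (2 * d + 1), \<gamma>]) \<in> J"
  using PredictI[OF assms(3-)] assms(1,2) unfolding closed_items_def by blast

lemma closed_items_Complete:
  assumes "closed_items L T k J" and "m \<le> k" and "(r, d, i, j, \<rho>) \<in> J" and "d < rule_len r"
    and "(r', rule_len r', j, m, \<xi>) \<in> J" and "lhs r' = rule_syms r ! d" and "\<rho> ! (2 * d + 1) = \<xi> ! 0"
    and "(rule_funs r ! Suc d) (\<rho> @ [\<xi> ! (2 * rule_len r' + 1)]) = Some \<gamma>"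
  shows "(r, Suc d, i, m, \<rho> @ [\<xi> ! (2 * rule_len r' + 1), \<gamma>]) \<in> J"
  using CompleteI[OF assms(3-)] assms(1,2) unfolding closed_items_def by blast

lemma closed_items_Scan:
  assumes "closed_items L T k J" and "j \<le> k" and "(r, d, i, j, \<rho>) \<in> J" and "d < rule_len r"
    and "(rule_syms r ! d, \<rho> ! (2 * d + 1), \<beta>, c) \<in> T j"
    and "(rule_funs r ! Suc d) (\<rho> @ [\<beta>]) = Some \<gamma>"
  shows "(r, Suc d, i, j + length c, \<rho> @ [\<beta>, \<gamma>]) \<in> J"
  using ScanI[OF assms(3-)] assms(1,2) unfolding closed_items_def by blast

text \<open>Whatever production expands a symbol, its rule can be predicted. This includes
  productions with \<open>Bot\<close>: \<open>1 \<le> h\<close> forces the first function to be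
  defined at \<open>\<alpha>\<close>.\<close>

lemma production_rest:
  assumes "(Sym N \<alpha> b, \<gamma>) \<in> induced_productions L"
  obtains r g where "r \<in> Rules L" and "lhs r = N" and "(rule_funs r ! 0) [\<alpha>] = Some g"
    and "rest r 0 [\<alpha>, g] \<gamma> b"
proof -
  have t: "take (Suc (Suc 0)) \<rho> = [\<rho> ! 0, \<rho> ! 1]" "take 1 \<rho> = [\<rho> ! 0]" if "length \<rho> \<ge> 2" for \<rho> :: "'a list"
    using that by (cases \<rho>; cases "tl \<rho>"; simp)+
  from assms consider r \<rho> where "Sym N \<alpha> b = Sym (lhs r) (\<rho> ! 0) (\<rho> ! (2 * rule_len r + 1))"
      "\<gamma> = annotate (rule_syms r) \<rho>" "r \<in> Rules L" "\<rho> \<in> param_seqs (Params L) (rule_funs r)"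
    | r h \<rho> \<beta> where "Sym N \<alpha> b = Sym (lhs r) (\<rho> ! 0) b" "1 \<le> h" "h \<le> rule_len r"
      "\<gamma> = annotate (take h (rule_syms r)) (\<rho> @ [\<beta>]) @ [Bot]" "r \<in> Rules L"
      "\<rho> \<in> param_seqs (Params L) (take h (rule_funs r))"
    unfolding induced_productions_def by blast
  then show thesis
  proof cases
    case (1 r \<rho>)
    have len: "length \<rho> \<ge> 2" using param_seqs_length[OF 1(4)] by simp
    have "(rule_funs r ! 0) (take 1 \<rho>) = Some (\<rho> ! 1)" using 1(4) by (force simp: param_seqs_def)
    with rest_full[OF 1(4), of 0] 1 t[OF len] that[of r "\<rho> ! 1"] show thesis by simp
  next
    case (2 r h \<rho> \<beta>)
    have len: "length \<rho> \<ge> 2" using param_seqs_length[OF 2(6)] 2(2,3) by simp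
    have "(rule_funs r ! 0) (take 1 \<rho>) = Some (\<rho> ! 1)" using 2(2,3,6) by (force simp: param_seqs_def)
    with rest_partial[OF 2(6,3), of 0] 2 t[OF len] that[of r "\<rho> ! 1"] show thesis by simp
  qed
qed

inductive_cases rest_NilE: "rest r d \<rho> [] b"

lemma rest_ConsE:
  assumes "rest r d \<rho> (X # s) b"
  obtains \<beta> \<gamma> where "X = Sym (rule_syms r ! d) (\<rho> ! (2 * d + 1)) \<beta>" and "d < rule_len r"
    and "(rule_funs r ! Suc d) (\<rho> @ [\<beta>]) = Some \<gamma>" and "rest r (Suc d) (\<rho> @ [\<beta>, \<gamma>]) s b"
  | \<beta> where "X = Sym (rule_syms r ! d) (\<rho> ! (2 * d + 1)) \<beta>" and "d < rule_len r" and "s = [Bot]"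
  using assms by (cases rule: rest.cases) auto

lemma yields_Nil [simp]: "yields G [] w \<longleftrightarrow> w = []"
  by (auto elim: yields.cases intro: yields.intros)

lemma yields_Bot: "yields (induced L) [Bot] w \<Longrightarrow> w = [Bot]"
  by (erule yields.cases) (auto simp: induced_productions_def)

text \<open>\<open>Bot\<close> is not the type of any token, so \<open>q\<close> is empty and
  \<open>Bot\<close> remains. Both parts of \<open>items_follow\<close> are then vacuous.\<close>

lemma items_follow_Bot:
  assumes "admissible (\<lambda>l. induced_token ` T l) j q" and "[Bot] = path_terminals q @ v"
  shows "items_follow J r i a b m v"
proof (cases q)
  case Nil
  with assms(2) show ?thesis by (auto simp: items_follow_def)
next
  case (Cons x q')
  with assms have "fst x = Bot" "x \<in> induced_token ` T j" by auto
  then show ?thesis by (auto elim!: induced_token.elims)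
qed

text \<open>The core of completeness. If the cut between \<open>q\<close> and \<open>v\<close> falls
  inside the tree of the first symbol after the dot, the witness comes from the predicted rule. If
  that tree is scanned to its end, its rule is completed, the dot moves, and the remaining trees
  take over.\<close>

lemma yields_items_follow:
  assumes "yields (induced L) s w" and closed: "closed_items L T k J"
    and "rest r d \<rho> s b" and "\<rho> \<noteq> []" and "(r, d, i, j, \<rho>) \<in> J"
    and "admissible (\<lambda>l. induced_token ` T l) j q" and "j + path_length q \<le> k"
    and "w = path_terminals q @ v"
  shows "items_follow J r i (\<rho> ! 0) b (j + path_length q) v"
  using assms(1,3-)
proof (induction arbitrary: r d \<rho> b i j q v rule: yields.induct)
  case Nil
  then show ?case by (auto simp: items_follow_def elim!: rest_NilE)
next
  case (keep s w X)
  from keep.prems(1) show ?case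
  proof (cases rule: rest_ConsE)
    case (1 \<beta> \<gamma>)
    show ?thesis
    proof (cases q)
      \<comment> \<open>Nothing is scanned and \<open>X\<close> is kept, so the given item is the
        one that expects the first remaining symbol.\<close>
      case Nil
      with keep.prems 1 show ?thesis by (fastforce simp: items_follow_def)
    next
      case (Cons x q')
      with keep.prems(5,6) 1 have x: "x = (Sym (rule_syms r ! d) (\<rho> ! (2 * d + 1)) \<beta>, snd x)"
        and j: "j \<le> k"
        by (auto simp: prod_eq_iff)
      with keep.prems(4) Cons have "(rule_syms r ! d, \<rho> ! (2 * d + 1), \<beta>, snd x) \<in> T j"
        by (metis admissible.simps(2) induced_token_mem_image)
      from closed_items_Scan[OF closed j keep.prems(3) 1(2) this 1(3)]
      have "(r, Suc d, i, j + length (snd x), \<rho> @ [\<beta>, \<gamma>]) \<in> J" .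
      from keep.IH[OF 1(4) _ this, of q' v] keep.prems Cons show ?thesis
        by (simp add: nth_append add.assoc)
    qed
  next
    case (2 \<beta>)
    with yields_Bot keep.hyps have w: "w = [Bot]" by blast
    show ?thesis
    proof (cases q)
      case Nil
      with keep.prems 2 show ?thesis by (fastforce simp: items_follow_def)
    next
      case (Cons x q')
      with keep.prems w show ?thesis by (auto intro!: items_follow_Bot[of T "j + length (snd x)" q'])
    qed
  qed
next
  case (expand X \<gamma>s w s w')
  from expand.prems(1) obtain \<beta> where d: "d < rule_len r"
    and X: "X = Sym (rule_syms r ! d) (\<rho> ! (2 * d + 1)) \<beta>"
    by (auto elim: rest_ConsE)
  have j: "j \<le> k" using expand.prems(5) by simp
  from expand.hyps(1) obtain r' g where r': "r' \<in> Rules L" "lhs r' = rule_syms r ! d"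
      "(rule_funs r' ! 0) [\<rho> ! (2 * d + 1)] = Some g"
    and rest': "rest r' 0 [\<rho> ! (2 * d + 1), g] \<gamma>s \<beta>"
    unfolding X by (auto elim: production_rest)
  note predicted = closed_items_Predict[OF closed j expand.prems(3) d r']
  note IH = expand.IH(1)[OF rest' _ predicted, simplified]
  show ?case
  \<comment> \<open>Requiring \<open>us \<noteq> []\<close> sends a cut exactly at the end of
    \<open>w\<close>, and with it a tree with empty frontier and empty \<open>q\<close>, to the case
    where the first symbol is completed.\<close>
  proof (cases "\<exists>us. us \<noteq> [] \<and> w = path_terminals q @ us \<and> us @ w' = v")
    case True
    then obtain us where us: "us \<noteq> []" "w = path_terminals q @ us" "us @ w' = v" by blast
    \<comment> \<open>A nonempty \<open>us\<close> determines the first symbol of \<open>v\<close>.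
      The item expecting it may belong to any rule, so the result for \<open>r'\<close> carries over
      to \<open>r\<close>.\<close>
    from IH[OF expand.prems(4,5) us(2)] us(1,3) show ?thesis
      by (auto simp: items_follow_def append_eq_Cons_conv)
  next
    case False
    with expand.prems(6) obtain us where us: "w @ us = path_terminals q" "w' = us @ v"
      by (auto simp: append_eq_append_conv2)
    from us(1)[symmetric] us(2) obtain q1 q2 where q: "q = q1 @ q2" and w: "w = path_terminals q1" "w' = path_terminals q2 @ v"
      unfolding path_terminals_def by (auto simp: map_eq_append_conv)
    have q1: "admissible (\<lambda>l. induced_token ` T l) j q1" "j + path_length q1 \<le> k"
      using expand.prems(4,5) q by auto
    from IH[OF q1, of "[]"] w obtain \<xi> where \<xi>: "(r', rule_len r', j, j + path_length q1, \<xi>) \<in> J"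
        "\<xi> ! 0 = \<rho> ! (2 * d + 1)" "\<xi> ! (2 * rule_len r' + 1) = \<beta>"
      by (auto simp: items_follow_def)
    from expand.prems(1) show ?thesis
    proof (cases rule: rest_ConsE)
      case (1 \<beta>' \<gamma>)
      with X have [simp]: "\<beta>' = \<beta>" by simp
      from closed_items_Complete[OF closed q1(2) expand.prems(3) d \<xi>(1) r'(2) \<xi>(2)[symmetric]] 1(3)
      have "(r, Suc d, i, j + path_length q1, \<rho> @ [\<beta>, \<gamma>]) \<in> J" by (simp add: \<xi>(3)[simplified])
      from expand.IH(2)[OF 1(4) _ this[folded \<open>\<beta>' = \<beta>\<close>], of q2 v] expand.prems q w show ?thesis
        by (simp add: nth_append add.assoc)
    next
      \<comment> \<open>The dot need not move past the first symbol: only \<open>Bot\<close>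
        follows, which no path can scan.\<close>
      case (2 \<beta>')
      with yields_Bot expand.hyps have "w' = [Bot]" by blast
      with w expand.prems(4) q show ?thesis
        by (intro items_follow_Bot[where q = q2 and j = "j + path_length q1"]) auto
    qed
  qed
qed

text \<open>The frontier consisting of the unexpanded start symbol is excluded because the initial
  items already lie inside its rules, and none of them has to expect the symbol itself.\<close>

lemma start_items_follow:
  assumes "yields (induced L) [Sym (Start L) (start_param L) b] (path_terminals q @ v)"
    and "path_terminals q @ v \<noteq> [Sym (Start L) (start_param L) b]"
    and closed: "closed_items L T k J"
    and "admissible (\<lambda>l. induced_token ` T l) 0 q" and "path_length q \<le> k"
  shows "\<exists>r \<in> Rules L. lhs r = Start L \<and> items_follow J r 0 (start_param L) b (path_length q) v"
proof -
  from assms(1,2) obtain \<gamma> where "(Sym (Start L) (start_param L) b, \<gamma>) \<in> induced_productions L"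
    and y: "yields (induced L) \<gamma> (path_terminals q @ v)"
    by (auto elim: yields.cases)
  then obtain r g where r: "r \<in> Rules L" "lhs r = Start L" "(rule_funs r ! 0) [start_param L] = Some g"
    and rest: "rest r 0 [start_param L, g] \<gamma> b"
    by (auto elim: production_rest)
  then have "(r, 0, 0, 0, [start_param L, g]) \<in> J"
    using closed unfolding closed_items_def Init_def by blast
  from yields_items_follow[OF y closed rest _ this assms(4)] assms(5) r show ?thesis by auto
qed

section \<open>The stages of the algorithm\<close>

lemma steps_increasing: "I \<subseteq> Predict L k I" "I \<subseteq> Complete k I" "I \<subseteq> Scan U k I"
  unfolding Predict_def Complete_def Scan_def by blast+

lemma Predict_chain:
  assumes "x \<in> Predict L k (\<Union>n::nat. F n)" shows "\<exists>n. x \<in> Predict L k (F n)"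
  using assms
proof (cases rule: Predict_cases)
  case 1
  then show ?thesis using steps_increasing(1) by blast
next
  case (2 r d i \<rho> r' \<gamma>)
  from 2(2) obtain n where "(r, d, i, k, \<rho>) \<in> F n" by blast
  from PredictI[OF this 2(3-)] 2(1) show ?thesis by blast
qed

text \<open>Completion combines two items that may enter at different indices, which is why the
  chain must be increasing.\<close>

lemma Complete_chain:
  assumes "x \<in> Complete k (\<Union>n::nat. F n)" and "\<And>m n. m \<le> n \<Longrightarrow> F m \<subseteq> F n"
  shows "\<exists>n. x \<in> Complete k (F n)"
  using assms(1)
proof (cases rule: Complete_cases)
  case 1
  then show ?thesis using steps_increasing(2) by blast
next
  case (2 r d i j \<rho> r' \<xi> \<gamma>)
  from 2(2,4) obtain m n where "(r, d, i, j, \<rho>) \<in> F m" "(r', rule_len r', j, k, \<xi>) \<in> F n" by blast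
  then have "(r, d, i, j, \<rho>) \<in> F (max m n)" "(r', rule_len r', j, k, \<xi>) \<in> F (max m n)"
    using assms(2)[of m "max m n"] assms(2)[of n "max m n"] by auto
  from CompleteI[OF this(1) 2(3) this(2) 2(5-)] 2(1) show ?thesis by blast
qed

lemma Scan_chain:
  assumes "x \<in> Scan U k (\<Union>n::nat. F n)" shows "\<exists>n. x \<in> Scan U k (F n)"
  using assms
proof (cases rule: Scan_cases)
  case 1
  then show ?thesis using steps_increasing(3) by blast
next
  case (2 r d i \<rho> \<beta> c \<gamma>)
  from 2(2) obtain n where "(r, d, i, k, \<rho>) \<in> F n" by blast
  from ScanI[OF this 2(3-)] 2(1) show ?thesis by blast
qed

lemma Scan_mono: "I \<subseteq> I' \<Longrightarrow> Scan U k I \<subseteq> Scan U k I'"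
  unfolding Scan_def by blast

lemma Complete_mono:
  assumes "I \<subseteq> I'" shows "Complete k I \<subseteq> Complete k I'"
proof
  fix x assume "x \<in> Complete k I"
  then show "x \<in> Complete k I'"
  proof (cases rule: Complete_cases)
    case 1
    then show ?thesis using assms steps_increasing(2) by blast
  next
    case (2 r d i j \<rho> r' \<xi> \<gamma>)
    from 2(2,4) assms have "(r, d, i, j, \<rho>) \<in> I'" "(r', rule_len r', j, k, \<xi>) \<in> I'" by auto
    from CompleteI[OF this(1) 2(3) this(2) 2(5-)] 2(1) show ?thesis by simp
  qed
qed

text \<open>Evidence for \<open>x\<close> is already present in some finite iterate, and one further
  round of \<open>f\<close> performs the step \<open>g\<close>. Thus the limit of a composition is
  closed under each of its factors.\<close>

lemma limit_closed:
  assumes "\<And>X. X \<subseteq> f X" and "\<And>X. g X \<subseteq> f X"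
    and "\<And>F x. (\<And>m n. m \<le> n \<Longrightarrow> F m \<subseteq> F n) \<Longrightarrow> x \<in> g (\<Union>n::nat. F n) \<Longrightarrow> \<exists>n. x \<in> g (F n)"
  shows "g (limit f X) \<subseteq> limit f X"
proof
  fix x assume "x \<in> g (limit f X)"
  then obtain n where "x \<in> g ((f ^^ n) X)"
    using assms(3)[of "\<lambda>n. (f ^^ n) X"] funpow_subset[of f, OF assms(1)] unfolding limit_def by blast
  then have "x \<in> (f ^^ Suc n) X" using assms(2) by auto
  then show "x \<in> limit f X" unfolding limit_def by blast
qed

lemma saturate_closed:
  "Predict L k (saturate L k U I) \<subseteq> saturate L k U I"
  "Complete k (saturate L k U I) \<subseteq> saturate L k U I"
  "Scan U k (saturate L k U I) \<subseteq> saturate L k U I"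
proof -
  let ?f = "Scan U k \<circ> Complete k \<circ> Predict L k"
  have P: "Predict L k X \<subseteq> ?f X" for X
    using steps_increasing(2,3) by (metis comp_apply subset_trans)
  have ext: "X \<subseteq> ?f X" for X using P steps_increasing(1) by (rule subset_trans[rotated])
  have C: "Complete k X \<subseteq> ?f X" for X
    using Complete_mono[OF steps_increasing(1)] steps_increasing(3) by (metis comp_apply subset_trans)
  have S: "Scan U k X \<subseteq> ?f X" for X
    using Scan_mono[OF subset_trans[OF steps_increasing(1) steps_increasing(2)]] by (metis comp_apply)
  show "Predict L k (saturate L k U I) \<subseteq> saturate L k U I" unfolding saturate_def
    by (rule limit_closed[OF ext P]) (rule Predict_chain)
  show "Complete k (saturate L k U I) \<subseteq> saturate L k U I" unfolding saturate_def
    by (rule limit_closed[OF ext C]) (rule Complete_chain)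
  show "Scan U k (saturate L k U I) \<subseteq> saturate L k U I" unfolding saturate_def
    by (rule limit_closed[OF ext S]) (rule Scan_chain)
qed

lemma subset_saturate: "I \<subseteq> saturate L k U I"
  unfolding saturate_def by (rule subset_limit)

text \<open>Prediction and completion at \<open>k\<close> add items that end at \<open>k\<close>,
  and scanning adds items that end at \<open>k\<close> or later.\<close>

lemma saturate_old:
  assumes "(r, d, i, j, \<rho>) \<in> saturate L k U I" and "j < k" shows "(r, d, i, j, \<rho>) \<in> I"
proof -
  let ?Y = "I \<union> {(r, d, i, j, \<rho>). k \<le> j}"
  have "Predict L k X \<subseteq> ?Y" "Complete k X \<subseteq> ?Y" "Scan U k X \<subseteq> ?Y" if "X \<subseteq> ?Y" for X
    using that by (auto elim!: Predict_cases Complete_cases Scan_cases)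
  then have "saturate L k U I \<subseteq> ?Y"
    unfolding saturate_def comp_def by (intro limit_subset) simp_all
  with assms show ?thesis by auto
qed

lemma items_mono: "u \<le> v \<Longrightarrow> items L D k u \<subseteq> items L D k v"
proof (induction v rule: dec_induct)
  case (step v)
  then show ?case using subset_saturate by (fastforce simp del: comp_apply)
qed simp

lemma items_Suc: "items L D k v \<subseteq> items L D (Suc k) u"
proof -
  have "items L D k v \<subseteq> items L D (Suc k) 0"
    using subset_saturate[of "\<Union>u. items L D k u" L "Suc k" "{}"] by auto
  then show ?thesis using items_mono[of 0 u] by blast
qed

lemma items_later: "l < k \<Longrightarrow> items L D l v \<subseteq> items L D k u"
proof (induction k arbitrary: u)
  case (Suc k)
  then show ?case using items_Suc[of L D k] by (cases "l = k") force+
qed simp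

text \<open>Items ending at or before \<open>l\<close> are settled once position \<open>l\<close> is
  left. This lets operations at an earlier position be replayed within the stages of that
  position.\<close>

lemma items_old:
  assumes "(r, d, i, j, \<rho>) \<in> items L D k u" and "j \<le> l" and "l < k"
  shows "\<exists>v. (r, d, i, j, \<rho>) \<in> items L D l v"
  using assms
proof (induction k arbitrary: u)
  case (Suc k)
  have "\<exists>v. (r, d, i, j, \<rho>) \<in> items L D k v"
    using Suc.prems(1)
  proof (induction u)
    case 0
    then show ?case using saturate_old[of r d i j \<rho> L "Suc k"] Suc.prems by force
  next
    case (Suc u)
    then show ?case using saturate_old[of r d i j \<rho> L "Suc k"] \<open>j \<le> l\<close> \<open>l < Suc k\<close> by force
  qed
  with Suc show ?case by (cases "l = k") auto
qed simp

lemma items_closed: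
  "Predict L k (items L D k u) \<subseteq> items L D k u"
  "Complete k (items L D k u) \<subseteq> items L D k u"
  "Scan (item_tokens L D k u) k (items L D k u) \<subseteq> items L D k u"
proof -
  \<comment> \<open>Stage \<open>0\<close> has this form as well, because it saturates with the
    empty set and \<open>item_tokens L D k 0\<close> is empty.\<close>
  obtain I where "items L D k u = saturate L k (item_tokens L D k u) I"
  proof (cases u)
    case 0
    then show thesis using that by (cases k) auto
  next
    case (Suc v)
    then show thesis using that by (auto simp del: item_tokens.simps)
  qed
  then show "Predict L k (items L D k u) \<subseteq> items L D k u"
    "Complete k (items L D k u) \<subseteq> items L D k u"
    "Scan (item_tokens L D k u) k (items L D k u) \<subseteq> items L D k u"
    by (simp_all add: saturate_closed)
qed

section \<open>Tokens selected so far, candidate tokens, and the invariants of the stages\<close>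

text \<open>Positions before \<open>k\<close> have run through all their stages, position
  \<open>k\<close> is at stage \<open>u\<close>, later positions have no tokens yet. This family
  determines the path sets and bounds the items.\<close>

definition tokens_upto ::
  "('p, 's, 'c) pll \<Rightarrow> 'c list \<Rightarrow> nat \<Rightarrow> nat \<Rightarrow> nat \<Rightarrow> ('p, 's, 'c) ptoken set" where
  "tokens_upto L D k u l =
     (if l < k then \<Union>v. item_tokens L D l v else if l = k then item_tokens L D k u else {})"

definition candidates ::
  "('p, 's, 'c) pll \<Rightarrow> 'c list \<Rightarrow> nat \<Rightarrow> ('p, 's) item set \<Rightarrow> ('p, 's, 'c) ptoken set" where
  "candidates L D k I =
     {x. \<exists>r d i \<rho>. (r, d, i, k, \<rho>) \<in> I \<and> d < rule_len r \<and> rule_syms r ! d \<in> Terms L \<and>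
        x \<in> Lex L (rule_syms r ! d) (\<rho> ! (2 * d + 1)) D k}"

lemma item_tokens_Suc:
  "item_tokens L D k (Suc u) = Sel L (item_tokens L D k u) (candidates L D k (items L D k u))"
  by (simp add: Tokens_def candidates_def)

lemma candidates_mono: "I \<subseteq> I' \<Longrightarrow> candidates L D k I \<subseteq> candidates L D k I'"
  unfolding candidates_def by blast

text \<open>Agreement with the input is phrased by \<open>take\<close> and \<open>drop\<close> so
  that it composes along consecutive tokens.\<close>

definition input_tokens ::
  "('p, 's, 'c) pll \<Rightarrow> 'c list \<Rightarrow> nat \<Rightarrow> ('p, 's, 'c) ptoken set" where
  "input_tokens L D k = {(t, \<alpha>, \<beta>, c). t \<in> Terms L \<and> \<alpha> \<in> Params L \<and> \<beta> \<in> Params L \<and>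
     c \<in> lists (Chars L) \<and> k + length c \<le> length D \<and> c = take (length c) (drop k D)}"

lemma input_tokens_path_chars:
  assumes "admissible (\<lambda>l. induced_token ` T l) j q" and "\<And>l. T l \<subseteq> input_tokens L D l"
    and "j \<le> length D"
  shows "j + path_length q \<le> length D \<and> path_chars q = take (path_length q) (drop j D)"
  using assms(1,3)
proof (induction q arbitrary: j)
  case (Cons x q)
  then obtain t \<alpha> \<beta> c where "(t, \<alpha>, \<beta>, c) \<in> T j" and x: "x = (Sym t \<alpha> \<beta>, c)"
    by (auto elim!: induced_token.elims)
  with assms(2) have c: "j + length c \<le> length D" "c = take (length c) (drop j D)"
    unfolding input_tokens_def by auto
  with Cons x have "j + length c + path_length q \<le> length D"
    "path_chars q = take (path_length q) (drop (j + length c) D)" by auto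
  with c x show ?case by (simp add: take_add add.commute)
qed simp

context parameterized_local_lexing
begin

lemma candidates_input_tokens:
  assumes "I \<subseteq> valid_items L T" and "D \<in> lists (Chars L)" and "k \<le> length D"
  shows "candidates L D k I \<subseteq> input_tokens L D k"
proof
  fix x assume "x \<in> candidates L D k I"
  then obtain r d i \<rho> where r: "(r, d, i, k, \<rho>) \<in> I" "d < rule_len r" "rule_syms r ! d \<in> Terms L"
    and x: "x \<in> Lex L (rule_syms r ! d) (\<rho> ! (2 * d + 1)) D k"
    unfolding candidates_def by blast
  from r assms(1) have \<alpha>: "\<rho> ! (2 * d + 1) \<in> Params L"
    by (auto simp: valid_items_def intro: param_seqs_nth_mem)
  from Lex[OF r(3) \<alpha> assms(2,3) x] obtain \<beta> c where
    "x = (rule_syms r ! d, \<rho> ! (2 * d + 1), \<beta>, c)" "\<beta> \<in> Params L" "c \<in> lists (Chars L)"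
    "k + length c \<le> length D" "\<forall>i < length c. c ! i = D ! (k + i)" by blast
  moreover from this have "c = take (length c) (drop k D)" by (intro nth_equalityI) auto
  ultimately show "x \<in> input_tokens L D k" using r \<alpha> unfolding input_tokens_def by auto
qed

text \<open>The two claims support each other: valid items yield well-formed candidates, the
  selector is constrained only if its first argument lies within such candidates, and scanning
  preserves validity only for well-formed tokens.\<close>

lemma items_valid:
  assumes "D \<in> lists (Chars L)" and "k \<le> length D"
  shows "items L D k u \<subseteq> valid_items L (tokens_upto L D k u) \<and>
    item_tokens L D k u \<subseteq> candidates L D k (items L D k u)"
proof -
  \<comment> \<open>Stage \<open>0\<close> is a premise so that the later induction on
    \<open>k\<close> can use all stages of \<open>k\<close> to reach stage \<open>0\<close> of
    \<open>Suc k\<close>.\<close>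
  have step: "items L D k u \<subseteq> valid_items L (tokens_upto L D k u) \<and>
      item_tokens L D k u \<subseteq> candidates L D k (items L D k u)"
    if base: "items L D k 0 \<subseteq> valid_items L (tokens_upto L D k 0)" and k: "k \<le> length D" for k u
  proof (induction u)
    case 0
    show ?case using base by simp
  next
    case (Suc u)
    let ?C = "candidates L D k (items L D k u)"
    have "?C \<subseteq> input_tokens L D k" using candidates_input_tokens Suc assms(1) k by blast
    then have C: "?C \<subseteq> Terms L \<times> Params L \<times> Params L \<times> lists (Chars L)"
      by (auto simp: input_tokens_def)
    from Sel[OF conjunct2[OF Suc] C] have sel: "item_tokens L D k u \<subseteq> item_tokens L D k (Suc u)"
      "item_tokens L D k (Suc u) \<subseteq> ?C"
      unfolding item_tokens_Suc by blast+
    from sel(1) have "tokens_upto L D k u l \<subseteq> tokens_upto L D k (Suc u) l" for l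
      unfolding tokens_upto_def by (simp del: item_tokens.simps)
    from valid_items_mono[of "tokens_upto L D k u", OF this] Suc
    have "items L D k u \<subseteq> valid_items L (tokens_upto L D k (Suc u))" by blast
    moreover have "item_tokens L D k (Suc u) \<subseteq> Terms L \<times> Params L \<times> Params L \<times> UNIV"
      using sel(2) C by blast
    ultimately have "items L D k (Suc u) \<subseteq> valid_items L (tokens_upto L D k (Suc u))"
      using saturate_valid[of "items L D k u" "tokens_upto L D k (Suc u)" "item_tokens L D k (Suc u)" k]
      by (simp add: tokens_upto_def del: item_tokens.simps)
    moreover have "?C \<subseteq> candidates L D k (items L D k (Suc u))"
      by (intro candidates_mono items_mono) simp
    ultimately show ?case using sel(2) by blast
  qed
  have "items L D k 0 \<subseteq> valid_items L (tokens_upto L D k 0)" using assms(2)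
  proof (induction k)
    case 0
    show ?case using saturate_valid[OF Init_valid, of "{}"] by simp
  next
    case (Suc k)
    have "tokens_upto L D k u l \<subseteq> tokens_upto L D (Suc k) 0 l" for u l
      by (auto simp: tokens_upto_def less_Suc_eq simp del: item_tokens.simps)
    from valid_items_mono[OF this] step Suc
    have "(\<Union>u. items L D k u) \<subseteq> valid_items L (tokens_upto L D (Suc k) 0)" by fastforce
    then show ?case using saturate_valid[of _ "tokens_upto L D (Suc k) 0" "{}" "Suc k"] by simp
  qed
  with step assms(2) show ?thesis by blast
qed

lemma item_tokens_mono:
  assumes "D \<in> lists (Chars L)" and "k \<le> length D" and "u \<le> v"
  shows "item_tokens L D k u \<subseteq> item_tokens L D k v"
  using assms(3)
proof (induction v rule: dec_induct)
  case (step v)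
  have C: "candidates L D k (items L D k v) \<subseteq> input_tokens L D k"
    using items_valid[OF assms(1,2)] assms(1,2) by (intro candidates_input_tokens) auto
  have "candidates L D k (items L D k v) \<subseteq> Terms L \<times> Params L \<times> Params L \<times> lists (Chars L)"
    using C by (auto simp: input_tokens_def)
  from Sel[OF conjunct2[OF items_valid[OF assms(1,2)]] this]
  have "item_tokens L D k v \<subseteq> item_tokens L D k (Suc v)" unfolding item_tokens_Suc ..
  with step show ?case by blast
qed simp

lemma tokens_upto_input_tokens:
  assumes "D \<in> lists (Chars L)" and "k \<le> length D"
  shows "tokens_upto L D k u l \<subseteq> input_tokens L D l"
proof -
  have *: "x \<in> input_tokens L D l" if "x \<in> item_tokens L D l v" "l \<le> k" for x l v
    using items_valid[OF assms(1), of l v] candidates_input_tokens[of "items L D l v"] assms that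
    by (meson le_trans subsetD)
  show ?thesis by (auto simp: tokens_upto_def simp del: item_tokens.simps intro: * split: if_splits)
qed

text \<open>For \<open>j < k\<close> the operands of an operation at \<open>j\<close> already occur
  in a stage of \<open>j\<close>. After moving them to a common stage, saturation there provides the
  result, which persists up to \<open>k\<close>.\<close>

lemma items_closed_items:
  assumes D: "D \<in> lists (Chars L)" "k \<le> length D"
  shows "closed_items L (tokens_upto L D k u) k (items L D k u)"
proof -
  have "Init L \<subseteq> items L D 0 0" using subset_saturate by simp
  then have "Init L \<subseteq> items L D k u"
    using items_later[of 0 k] items_mono[of 0 u L D 0] by (cases k) force+
  moreover have "Predict L j (items L D k u) \<subseteq> items L D k u \<and>
      Complete j (items L D k u) \<subseteq> items L D k u \<and>
      Scan (tokens_upto L D k u j) j (items L D k u) \<subseteq> items L D k u" if "j \<le> k" for j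
  proof (cases "j = k")
    case True
    then show ?thesis by (simp add: tokens_upto_def items_closed)
  next
    case False
    with that have j: "j < k" by simp
    have later: "x \<in> items L D j v \<Longrightarrow> x \<in> items L D k u" for x v
      using items_later[OF j] by blast
    show ?thesis
    proof (intro conjI subsetI)
      fix x assume "x \<in> Predict L j (items L D k u)"
      then show "x \<in> items L D k u"
      proof (cases rule: Predict_cases)
        case (2 r d i \<rho> r' \<gamma>)
        from items_old[OF 2(2) _ j] obtain v where "(r, d, i, j, \<rho>) \<in> items L D j v" by blast
        from PredictI[OF this 2(3-)] 2(1) have "x \<in> items L D j v" using items_closed(1) by blast
        then show ?thesis by (rule later)
      qed
    next
      fix x assume "x \<in> Complete j (items L D k u)"
      then show "x \<in> items L D k u"
      proof (cases rule: Complete_cases)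
        case (2 r d i h \<rho> r' \<xi> \<gamma>)
        \<comment> \<open>The item to be advanced ends at \<open>h\<close>, where the completed one
          starts. Validity gives \<open>h \<le> j\<close>, so both items are old.\<close>
        from 2(4) items_valid[OF D] have "(r', rule_len r', h, j, \<xi>) \<in> valid_items L (tokens_upto L D k u)"
          by blast
        then have "h \<le> j" by (auto simp: valid_items_def)
        with items_old[OF 2(2) _ j] items_old[OF 2(4) _ j] obtain v w where
          "(r, d, i, h, \<rho>) \<in> items L D j v" "(r', rule_len r', h, j, \<xi>) \<in> items L D j w" by blast
        then have "(r, d, i, h, \<rho>) \<in> items L D j (max v w)"
          "(r', rule_len r', h, j, \<xi>) \<in> items L D j (max v w)"
          using items_mono[of v "max v w" L D j] items_mono[of w "max v w" L D j] by auto
        from CompleteI[OF this(1) 2(3) this(2) 2(5-)] 2(1) have "x \<in> items L D j (max v w)"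
          using items_closed(2) by blast
        then show ?thesis by (rule later)
      qed
    next
      fix x assume "x \<in> Scan (tokens_upto L D k u j) j (items L D k u)"
      then show "x \<in> items L D k u"
      proof (cases rule: Scan_cases)
        case (2 r d i \<rho> \<beta> c \<gamma>)
        from 2(4) j obtain w where "(rule_syms r ! d, \<rho> ! (2 * d + 1), \<beta>, c) \<in> item_tokens L D j w"
          unfolding tokens_upto_def by (auto simp del: item_tokens.simps)
        moreover from items_old[OF 2(2) _ j] obtain v where "(r, d, i, j, \<rho>) \<in> items L D j v" by blast
        ultimately have "(rule_syms r ! d, \<rho> ! (2 * d + 1), \<beta>, c) \<in> item_tokens L D j (max v w)"
          "(r, d, i, j, \<rho>) \<in> items L D j (max v w)"
          using items_mono[of v "max v w" L D j] item_tokens_mono[OF D(1), of j w "max v w"] j D(2) by auto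
        from ScanI[OF this(2) 2(3) this(1) 2(5)] 2(1) have "x \<in> items L D j (max v w)"
          using items_closed(3) by blast
        then show ?thesis by (rule later)
      qed
    qed
  qed
  ultimately show ?thesis unfolding closed_items_def by blast
qed

section \<open>Agreement of the path sets with the item sets\<close>

lemma language_prefix_induced:
  assumes "derives (induced L) [Top] (w @ v)" and "w \<in> lists (terminals (induced L))"
  shows "w \<in> language_prefix (induced L)"
  using assms derives_carrier[OF assms(1)] unfolding language_prefix_def
  by (auto simp del: induced_sel(1,2) simp: subset_iff intro!: bexI[of _ v])

lemma admissible_induced_terminals:
  assumes "admissible (\<lambda>l. induced_token ` T l) j q" and "\<And>l. T l \<subseteq> input_tokens L D l"
  shows "path_terminals q \<in> lists (terminals (induced L))"
  using assms(1)
proof (rule admissible_terminals)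
  fix l x assume "x \<in> induced_token ` T l"
  with assms(2)[of l] show "fst x \<in> terminals (induced L)" by (auto simp: input_tokens_def)
qed

text \<open>Completeness turns a viable continuation into an item that expects its terminal.
  Conversely, the lexer chooses the output parameter of a candidate, and soundness still provides a
  path it can follow because \<open>valid_items_next\<close> admits every output parameter.\<close>

lemma tokens_following_candidates:
  assumes D: "D \<in> lists (Chars L)" "k \<le> length D"
  shows "tokens_following (induced L) D k (admissible_paths (induced L) (\<lambda>l. induced_token ` tokens_upto L D k u l))
    = induced_token ` candidates L D k (items L D k u)" (is "?F = ?C")
proof (intro subset_antisym subsetI)
  fix x assume "x \<in> ?F"
  then obtain p where x: "x \<in> tokens_at (induced L) D k" and len: "path_length p = k"
    and p: "admissible (\<lambda>l. induced_token ` tokens_upto L D k u l) 0 p"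
    and "path_terminals p @ [fst x] \<in> language_prefix (induced L)"
    unfolding tokens_following_def admissible_paths_def by auto
  then obtain v where "derives (induced L) [Top] (path_terminals p @ fst x # v)"
    unfolding language_prefix_def by auto
  then have y: "yields (induced L) [Top] (path_terminals p @ fst x # v)" by (rule derives_yields)
  from x obtain t \<alpha> \<beta> c where x': "x = (Sym t \<alpha> \<beta>, c)" and t: "t \<in> Terms L"
    and lex: "(t, \<alpha>, \<beta>, c) \<in> Lex L t \<alpha> D k"
    unfolding tokens_at_def by auto
  from y obtain b where y': "yields (induced L) [Sym (Start L) (start_param L) b] (path_terminals p @ fst x # v)"
    using x' by cases (auto simp: Cons_eq_append_conv append_eq_Cons_conv induced_productions_def)
  \<comment> \<open>The frontier contains the terminal \<open>fst x\<close>, which cannot be the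
    start symbol.\<close>
  have "path_terminals p @ fst x # v \<noteq> [Sym (Start L) (start_param L) b]"
    using x' t disjoint start_nonterm by (auto simp: append_eq_Cons_conv)
  from start_items_follow[OF y' this items_closed_items[OF D] p] len x' obtain r d i \<rho> where
    "(r, d, i, k, \<rho>) \<in> items L D k u" "d < rule_len r" "rule_syms r ! d = t" "\<rho> ! (2 * d + 1) = \<alpha>"
    unfolding items_follow_def by auto
  with t lex have "(t, \<alpha>, \<beta>, c) \<in> candidates L D k (items L D k u)" unfolding candidates_def by blast
  then show "x \<in> ?C" using x' by force
next
  fix x assume "x \<in> ?C"
  then obtain y where y: "y \<in> candidates L D k (items L D k u)" "x = induced_token y" by blast
  from y(1) obtain r d i \<rho> where r: "(r, d, i, k, \<rho>) \<in> items L D k u" "d < rule_len r"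
    and t: "rule_syms r ! d \<in> Terms L" and lex: "y \<in> Lex L (rule_syms r ! d) (\<rho> ! (2 * d + 1)) D k"
    unfolding candidates_def by blast
  have v: "(r, d, i, k, \<rho>) \<in> valid_items L (tokens_upto L D k u)"
    using items_valid[OF D] r(1) by blast
  then have \<alpha>: "\<rho> ! (2 * d + 1) \<in> Params L"
    using r(2) by (auto simp: valid_items_def intro: param_seqs_nth_mem)
  from Lex[OF t \<alpha> D lex] obtain \<beta> c where y': "y = (rule_syms r ! d, \<rho> ! (2 * d + 1), \<beta>, c)"
    and \<beta>: "\<beta> \<in> Params L" by blast
  let ?X = "Sym (rule_syms r ! d) (\<rho> ! (2 * d + 1)) \<beta>"
  from valid_items_next[OF v r(2)] \<beta> obtain p v where
    p: "admissible (\<lambda>l. induced_token ` tokens_upto L D k u l) 0 p" "path_length p = k"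
    and d: "derives (induced L) [Top] (path_terminals p @ ?X # v)" by metis
  have X: "?X \<in> terminals (induced L)" using t \<alpha> \<beta> by simp
  have "path_terminals p \<in> lists (terminals (induced L))"
    using admissible_induced_terminals[OF p(1)] tokens_upto_input_tokens[OF D] by blast
  with d X have prefix: "path_terminals p @ [?X] \<in> language_prefix (induced L)"
    by (intro language_prefix_induced[where v = v]) simp_all
  have "p \<in> admissible_paths (induced L) (\<lambda>l. induced_token ` tokens_upto L D k u l)"
    unfolding admissible_paths_def using p(1) prefix by (auto dest: language_prefix_appendD)
  moreover have "x \<in> lexer (induced L) ?X D k" using lex y(2) y' by simp
  with X have "x \<in> tokens_at (induced L) D k" unfolding tokens_at_def by blast
  ultimately show "x \<in> ?F" unfolding tokens_following_def using p(2) prefix y(2) y' by auto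
qed

lemma paths_characterization:
  assumes D: "D \<in> lists (Chars L)" "k \<le> length D"
  shows "selected (induced L) D k u = induced_token ` item_tokens L D k u \<and>
    paths (induced L) D k u = admissible_paths (induced L) (\<lambda>l. induced_token ` tokens_upto L D k u l)"
proof -
  have step: "selected (induced L) D k u = induced_token ` item_tokens L D k u \<and>
      paths (induced L) D k u = admissible_paths (induced L) (\<lambda>l. induced_token ` tokens_upto L D k u l)"
    if base: "paths (induced L) D k 0 =
        admissible_paths (induced L) (\<lambda>l. induced_token ` tokens_upto L D k 0 l)"
      and k: "k \<le> length D" for k u
  proof (induction u)
    case 0
    show ?case using base by simp
  next
    case (Suc u)
    \<comment> \<open>Injectivity of \<open>induced_token\<close> cancels the preimages in the
      induced selector, so \<open>Sel L\<close> receives the same arguments on both sides.\<close>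
    then have sel: "selected (induced L) D k (Suc u) = induced_token ` item_tokens L D k (Suc u)"
      unfolding item_tokens_Suc
      by (simp add: tokens_following_candidates[OF D(1) k] induced_selector_def
          inj_vimage_image_eq[OF inj_induced_token] del: item_tokens.simps)
    let ?Z = "\<lambda>l. induced_token ` tokens_upto L D k u l"
    have "?Z k \<subseteq> induced_token ` item_tokens L D k (Suc u)"
      using item_tokens_mono[OF D(1) k, of u "Suc u"]
      by (auto simp: tokens_upto_def simp del: item_tokens.simps)
    moreover have "?Z l = {}" if "l > k" for l using that by (simp add: tokens_upto_def)
    moreover have "?Z(k := induced_token ` item_tokens L D k (Suc u)) =
        (\<lambda>l. induced_token ` tokens_upto L D k (Suc u) l)"
      by (auto simp: fun_eq_iff tokens_upto_def simp del: item_tokens.simps)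
    ultimately have "limit (Append (induced L) (induced_token ` item_tokens L D k (Suc u)) k)
        (admissible_paths (induced L) ?Z) =
        admissible_paths (induced L) (\<lambda>l. induced_token ` tokens_upto L D k (Suc u) l)"
      using limit_Append[of ?Z k "induced_token ` item_tokens L D k (Suc u)" "induced L"] by simp
    then show ?case using Suc sel by (simp del: item_tokens.simps selected.simps)
  qed
  have "paths (induced L) D k 0 =
      admissible_paths (induced L) (\<lambda>l. induced_token ` tokens_upto L D k 0 l)" using D(2)
  proof (induction k)
    case 0
    have "[] \<in> language_prefix (induced L)"
      \<comment> \<open>\<open>Top\<close> is an allowed remainder, so the empty path is viable even
        if the language is empty.\<close>
      by (rule language_prefix_induced[where v = "[Top]"]) (simp_all add: derives_refl)
    moreover have "tokens_upto L D 0 0 = (\<lambda>_. {})" by (simp add: fun_eq_iff tokens_upto_def)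
    moreover have "admissible (\<lambda>_. {}) j p \<longleftrightarrow> p = []" for j :: nat and p :: "(('a, 'b) isym, 'c) path"
      by (cases p) auto
    ultimately show ?case by (auto simp: admissible_paths_def)
  next
    case (Suc k)
    let ?Z = "\<lambda>u l. induced_token ` tokens_upto L D k u l"
    let ?Z' = "\<lambda>l. induced_token ` tokens_upto L D (Suc k) 0 l"
    have k: "k \<le> length D" using Suc.prems by simp
    have P: "paths (induced L) D k u = admissible_paths (induced L) (?Z u)" for u
      using step[OF Suc.IH[OF k] k] by blast
    have mono: "tokens_upto L D k u l \<subseteq> tokens_upto L D k v l" if "u \<le> v" for u v l
      using item_tokens_mono[OF D(1) k that] by (auto simp: tokens_upto_def simp del: item_tokens.simps)
    have union: "tokens_upto L D (Suc k) 0 l = (\<Union>v. tokens_upto L D k v l)" for l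
      by (cases l k rule: linorder_cases) (auto simp: tokens_upto_def simp del: item_tokens.simps(2))
    \<comment> \<open>A path has finitely many tokens, so a single stage supplies all of
      them.\<close>
    have finite_path: "\<exists>u. admissible (?Z u) j p" if "admissible ?Z' j p" for j p
      using that
    proof (induction p arbitrary: j)
      case (Cons x p)
      then obtain u where u: "admissible (?Z u) (j + length (snd x)) p" by auto
      from Cons.prems obtain v where v: "x \<in> ?Z v j"
        by (auto simp: union)
      have "admissible (?Z (max u v)) (j + length (snd x)) p"
        using u by (rule admissible_mono) (use mono[of u "max u v"] in auto)
      moreover have "x \<in> ?Z (max u v) j" using v mono[of v "max u v"] by auto
      ultimately show ?case by auto
    qed simp
    have "admissible ?Z' 0 p" if "admissible (?Z u) 0 p" for u p
      using that by (rule admissible_mono) (auto simp: union)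
    with finite_path[of 0] have "admissible ?Z' 0 p \<longleftrightarrow> (\<exists>u. admissible (?Z u) 0 p)" for p by metis
    then have "(\<Union>u. admissible_paths (induced L) (?Z u)) = admissible_paths (induced L) ?Z'"
      unfolding admissible_paths_def by auto
    then show ?case using P by simp
  qed
  from step[OF this D(2)] show ?thesis .
qed

end

theorem theorem2:
  fixes L :: "('p, 's, 'c) pll" and D :: "'c list"
  assumes "parameterized_local_lexing L"
    and "D \<in> lists (Chars L)"
  shows "outputs L D =
    {\<rho> ! (2 * u + 1) | r u \<rho>.
       (r, u, 0, length D, \<rho>) \<in> PELLA L D \<and>
       r \<in> Rules L \<and> lhs r = Start L \<and> u = rule_len r \<and> \<rho> ! 0 = start_param L}"
proof -
  interpret parameterized_local_lexing L by fact
  let ?k = "length D"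
  let ?T = "tokens_upto L D ?k"
  have paths: "paths (induced L) D ?k u = admissible_paths (induced L) (\<lambda>l. induced_token ` ?T u l)" for u
    using paths_characterization[OF assms(2) order_refl] by blast
  have input: "?T u l \<subseteq> input_tokens L D l" for u l
    using tokens_upto_input_tokens[OF assms(2) order_refl] .
  have "\<exists>r \<xi>. b = \<xi> ! (2 * rule_len r + 1) \<and> (r, rule_len r, 0, ?k, \<xi>) \<in> PELLA L D \<and>
      r \<in> Rules L \<and> lhs r = Start L \<and> \<xi> ! 0 = start_param L" if b: "b \<in> outputs L D" for b
  proof -
    from b obtain p u where p: "admissible (\<lambda>l. induced_token ` ?T u l) 0 p" "path_chars p = D"
      and d: "derives (induced L) [Sym (Start L) (start_param L) b] (path_terminals p)"
      unfolding outputs_def parses_def all_paths_def paths admissible_paths_def by auto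
    have "path_terminals p \<in> lists (terminals (induced L))"
      using admissible_induced_terminals[OF p(1) input] .
    then have "path_terminals p @ [] \<noteq> [Sym (Start L) (start_param L) b]"
      using disjoint start_nonterm by auto
    \<comment> \<open>With an empty remainder, \<open>items_follow\<close> provides a completed item
      of a start rule whose output parameter is \<open>b\<close>.\<close>
    from start_items_follow[OF _ this items_closed_items[OF assms(2) order_refl] p(1)] derives_yields[OF d] p(2)
    obtain r \<xi> where "r \<in> Rules L" "lhs r = Start L" "(r, rule_len r, 0, ?k, \<xi>) \<in> items L D ?k u"
      "\<xi> ! 0 = start_param L" "\<xi> ! (2 * rule_len r + 1) = b"
      unfolding items_follow_def by auto
    then show ?thesis unfolding PELLA_def by blast
  qed
  moreover have "\<rho> ! (2 * rule_len r + 1) \<in> outputs L D"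
    if item: "(r, rule_len r, 0, ?k, \<rho>) \<in> PELLA L D" and r: "r \<in> Rules L" "lhs r = Start L"
      "\<rho> ! 0 = start_param L" for r \<rho>
  proof -
    let ?b = "\<rho> ! (2 * rule_len r + 1)"
    let ?S = "Sym (Start L) (start_param L) ?b"
    from item obtain u where "(r, rule_len r, 0, ?k, \<rho>) \<in> items L D ?k u"
      unfolding PELLA_def by blast
    then have "(r, rule_len r, 0, ?k, \<rho>) \<in> valid_items L (?T u)"
      using items_valid[OF assms(2) order_refl] by blast
    then obtain q where \<rho>: "\<rho> \<in> param_seqs (Params L) (rule_funs r)"
      and q: "admissible (\<lambda>l. induced_token ` ?T u l) 0 q" "path_length q = ?k"
        "derives (induced L) (annotate (rule_syms r) \<rho>) (path_terminals q)"
      unfolding valid_items_def by auto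
    have "?b \<in> Params L" using \<rho> by (auto intro: param_seqs_nth_mem)
    then have "(Top, [?S]) \<in> productions (induced L)" by (auto simp: induced_productions_def)
    then have S: "derives1 (induced L) [Top] [?S]" "derives (induced L) [Top] [?S]"
      by (auto simp: derives1_def Cons_eq_append_conv intro: derives_production)
    have d: "derives (induced L) [?S] (path_terminals q)"
      using derives_trans[OF derives_production q(3)] production_full[OF r(1) \<rho>] r by simp
    have ts: "path_terminals q \<in> lists (terminals (induced L))"
      using admissible_induced_terminals[OF q(1) input] .
    have "derives (induced L) [Top] (path_terminals q)" using S(2) d by (rule derives_trans)
    then have "path_terminals q \<in> language_prefix (induced L)" "path_terminals q \<in> language (induced L)"
      using ts language_prefix_induced[of "path_terminals q" "[]"] by (simp_all add: language_def)
    \<comment> \<open>The tokens agree with the input where they start, so a path from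
      \<open>0\<close> of full length spells \<open>D\<close>.\<close>
    moreover have "path_chars q = D"
      using input_tokens_path_chars[OF q(1) input] q(2) by simp
    ultimately have "q \<in> parses (induced L) D"
      unfolding parses_def all_paths_def paths admissible_paths_def using q(1) by blast
    then show ?thesis unfolding outputs_def using S(1) d by blast
  qed
  ultimately show ?thesis by blast
qed

end
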